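(* Let $a,\lambda\in\mathbb C$ be such that the quadratic polynomial $q(z):=1+az+\lambda z^2$ has no zeros on the closed unit disc $\overline{\mathbb D}$ (equivalently, $|\lambda|<1$ and $|a-\bar a\lambda|<1-|\lambda|^2$). Given $c>0$, let $F:\mathbb D\to\mathbb C$ be the holomorphic map determined by $F(0)=0$ and $F'(z)=\dfrac{c}{1+az+\lambda z^2}$. Then $F$ is a biholomorphic map onto the bounded strongly convex domain $D=F(\mathbb D)$, and $M_D(0)=|F'(0)|=c$. Moreover, the harmonic maps $f:\mathbb D\to D$ with $f(0)=0$ and $df_0$ conformal that attain $\|df_0\|=M_D(0)$ are exactly the maps \[ z\longmapsto F(e^{i\theta}z)\quad\text{and}\quad z\longmapsto F(e^{i\theta}\bar z),\qquad \theta\in\mathbb R. \]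
   Context: $\mathbb D=\{z\in\mathbb C:|z|<1\}$. For a domain $D\subset\mathbb C$ and $p\in D$, $M_D(p)$ denotes the supremum of the operator norms $\|df_0\|$ over all harmonic maps $f:\mathbb D\to D$ with $f(0)=p$ whose differential $df_0:\mathbb R^2\to\mathbb R^2$ at $0$ is conformal (i.e. a nonnegative multiple of an orthogonal linear map, orientation preserving or reversing). *)

theory Defs
  imports "HOL-Complex_Analysis.Complex_Analysis"
begin

abbreviation unit_disc :: "complex set" where
  "unit_disc \<equiv> ball 0 1"

definition harmonic_on :: "(complex \<Rightarrow> complex) \<Rightarrow> complex set \<Rightarrow> bool" where
  "harmonic_on f S \<longleftrightarrow> open S \<and>
     (\<exists>Df D2f.
        (\<forall>z\<in>S. (f has_derivative Df z) (at z)) \<and>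
        (\<forall>z\<in>S. \<forall>u. ((\<lambda>w. Df w u) has_derivative D2f z u) (at z)) \<and>
        (\<forall>u v. continuous_on S (\<lambda>w. D2f w u v)) \<and>
        (\<forall>z\<in>S. D2f z 1 1 + D2f z \<i> \<i> = 0))"

definition conformal_linear :: "(complex \<Rightarrow> complex) \<Rightarrow> bool" where
  "conformal_linear L \<longleftrightarrow>
     (\<exists>c::real. c \<ge> 0 \<and> (\<exists>T. orthogonal_transformation T \<and> L = (\<lambda>h. c *\<^sub>R T h)))"

definition admissible :: "complex set \<Rightarrow> complex \<Rightarrow> (complex \<Rightarrow> complex) \<Rightarrow> bool" where
  "admissible D p f \<longleftrightarrow> harmonic_on f unit_disc \<and> f ` unit_disc \<subseteq> D \<and> f 0 = p \<and>
     conformal_linear (frechet_derivative f (at 0))"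

text \<open>M_D(p), valued in the extended reals (so that it is meaningful also when unbounded).\<close>
definition M :: "complex set \<Rightarrow> complex \<Rightarrow> ereal" where
  "M D p = (SUP f\<in>{f. admissible D p f}. ereal (onorm (frechet_derivative f (at 0))))"

definition strongly_convex_domain :: "complex set \<Rightarrow> bool" where
  "strongly_convex_domain D \<longleftrightarrow> open D \<and> connected D \<and> D \<noteq> {} \<and> bounded D \<and> convex D \<and>
     (\<exists>U (\<rho>::complex \<Rightarrow> real) D\<rho> D2\<rho>. open U \<and> closure D \<subseteq> U \<and>
        (\<forall>z\<in>U. (\<rho> has_derivative D\<rho> z) (at z)) \<and>
        (\<forall>z\<in>U. \<forall>u. ((\<lambda>w. D\<rho> w u) has_derivative D2\<rho> z u) (at z)) \<and>
        (\<forall>u v. continuous_on U (\<lambda>w. D2\<rho> w u v)) \<and>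
        D = {z\<in>U. \<rho> z < 0} \<and>
        (\<forall>z\<in>frontier D. \<rho> z = 0 \<and> D\<rho> z \<noteq> (\<lambda>_. 0) \<and>
            (\<forall>v. v \<noteq> 0 \<and> D\<rho> z v = 0 \<longrightarrow> D2\<rho> z v v > 0)))"

end

theory Submission
  imports Defs
begin

text \<open>
  Write \<open>q z = (1 - \<alpha> z) (1 - \<beta> z)\<close>. The half plane below the tangent to \<open>F (sphere 0 1)\<close> at
  \<open>F \<zeta>\<close> is \<open>Re ((w - F \<zeta>) q \<zeta> / \<zeta>) < 0\<close>, and on the circle the weight \<open>q \<zeta> / \<zeta>\<close> is the
  trigonometric polynomial \<open>cnj \<zeta> + a + \<lambda> \<zeta>\<close>. For a harmonic \<open>f = H + cnj G\<close> into the image,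
  integrating this inequality with \<open>w = f (r \<zeta>)\<close> over the circle therefore only sees the first
  Fourier coefficients and gives \<open>Re (H' 0 + \<lambda> cnj (G' 0)) \<le> c\<close>; conformality says that
  \<open>H' 0 = 0\<close> or \<open>G' 0 = 0\<close>. In the case of equality the integrand tends to \<open>0\<close> in mean as
  \<open>r\<close> tends to \<open>1\<close>, and strict convexity forces \<open>f = F\<close>.
\<close>

section \<open>Tangent lines of the image curves\<close>

text \<open>The curve \<open>F (cis t)\<close> has velocity
  \<open>\<i> * c * \<zeta> / q \<zeta>\<close> at \<zeta> = \<open>cis t\<close>, so its outward
  normal is a positive multiple of n = \<open>\<zeta> / q \<zeta>\<close>, and
  \<open>Re (x / n)\<close> has the sign of the inner product of x and n. This is the origin of the
  weight \<open>q \<zeta> / \<zeta>\<close>; since \<open>q\<close> has degree at most 2, only the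
  frequencies -1, 0 and 1 occur in it. The bound c is the mean of
  \<open>F \<zeta> * (q \<zeta> / \<zeta>)\<close> over the circle. A competitor need not have
  boundary values, so it is sampled at radius r < 1 but compared with the tangent lines at radius 1.
  For this \<open>F\<close> must be holomorphic beyond the closed disc, which the absence of zeros
  on the closed disc permits. The integral estimate is carried out for \<open>deriv G 0 = 0\<close>,
  which removes \<lambda> from it; composition with conjugation turns the other conformal case into
  this one. Equality is reached only in the limit, so strict convexity is needed in a uniform form:
  the distance to \<open>F \<zeta>\<close> is at most \<epsilon> plus a multiple of the depth below
  the tangent.\<close>

lemma has_vector_derivative_comp_cis:
  assumes "(K has_field_derivative K') (at (cis t))"
  shows "((\<lambda>t. K (cis t)) has_vector_derivative (\<i> * cis t * K')) (at t)"
proof -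
  have "(cis has_vector_derivative \<i> * cis t) (at t)"
    by (auto simp: has_vector_derivative_complex_iff intro!: derivative_eq_intros)
  from field_vector_diff_chain_at[OF this assms] show ?thesis by (simp add: o_def)
qed

lemma norm_mult_less_1:
  fixes x z :: complex
  assumes "norm x * R \<le> 1" "norm z < R"
  shows "norm (x * z) < 1"
proof (cases "x = 0")
  case False
  then have "norm x * norm z < norm x * R" using assms by (intro mult_strict_left_mono) auto
  then show ?thesis using assms by (simp add: norm_mult)
qed auto

text \<open>The expression is half of the Cayley transform \<open>(1 + w) / (1 - w)\<close> from the
  disc to the right half plane. It is halved because two copies, one for \<alpha> and one for
  \<beta>, share the constant 1 in the turning rate of the tangent.\<close>

lemma Re_half_moebius_pos:
  fixes w :: complex
  assumes "norm w < 1"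
  shows "Re (1/2 + w / (1 - w)) > 0"
proof -
  have ne: "1 - w \<noteq> 0" using assms by auto
  have "1/2 + w / (1 - w) = (1 + w) * cnj (1 - w) / (2 * ((1 - w) * cnj (1 - w)))"
    using ne by (simp add: divide_simps)
  also have "\<dots> = (1 + w) * cnj (1 - w) / of_real (2 * (norm (1 - w))\<^sup>2)"
    by (simp only: complex_norm_square[symmetric] of_real_mult of_real_numeral)
  finally have "Re (1/2 + w / (1 - w)) = Re ((1 + w) * cnj (1 - w)) / (2 * (norm (1 - w))\<^sup>2)"
    by (metis Re_divide_of_real)
  moreover have "Re ((1 + w) * cnj (1 - w)) = 1 - (norm w)\<^sup>2"
    by (simp only: cmod_power2) (simp add: algebra_simps power2_eq_square)
  moreover have "(norm w)\<^sup>2 < 1" using assms by (simp add: power_less_one_iff)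
  ultimately show ?thesis using ne by simp
qed

lemma Re_one_minus_pos:
  fixes w :: complex
  assumes "norm w < 1"
  shows "Re (1 - w) > 0"
  using assms abs_Re_le_cmod[of w] by simp

text \<open>The tangent angle \<open>\<Psi>\<close> of the boundary curve is increasing, because its derivative
  is the sum of two half-plane-valued Moebius terms, and it makes exactly one turn. Hence the
  height over the tangent line at \<open>1\<close> first decreases and then increases back to \<open>0\<close>.\<close>

lemma circle_below_tangent:
  fixes H :: "complex \<Rightarrow> complex" and \<alpha> \<beta> :: complex
  assumes \<alpha>: "norm \<alpha> < 1" and \<beta>: "norm \<beta> < 1"
    and H: "\<And>z. norm z \<le> 1 \<Longrightarrow> (H has_field_derivative 1 / ((1 - \<alpha>*z) * (1 - \<beta>*z))) (at z)"
    and t: "0 < t" "t < 2 * pi"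
  shows "Re ((H (cis t) - H 1) * ((1 - \<alpha>) * (1 - \<beta>))) < 0"
proof -
  define L where "L z = Ln (1 - \<alpha>*z) + Ln (1 - \<beta>*z)" for z
  \<comment> \<open>The velocity of \<open>H (cis s)\<close> is
    \<open>\<i> * cis s / exp (L (cis s))\<close>, so \<open>\<Psi> s\<close> is its argument
    relative to the one at \<open>s = 0\<close>. Both factors stay in the right half plane, so
    \<open>L\<close> is a continuous logarithm and returns to its value after one turn.\<close>
  define \<Psi> where "\<Psi> s = s - Im (L (cis s)) + Im (L 1)" for s
  define g where "g s = Re ((H (cis s) - H 1) * ((1 - \<alpha>) * (1 - \<beta>)))" for s
  have small: "norm (\<alpha> * cis s) < 1" "norm (\<beta> * cis s) < 1" for s
    using \<alpha> \<beta> by (simp_all add: norm_mult)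
  have pos: "Re (1 - \<alpha> * cis s) > 0" "Re (1 - \<beta> * cis s) > 0" for s
    using small by (blast intro: Re_one_minus_pos)+
  have nz: "1 - \<alpha> * cis s \<noteq> 0" "1 - \<beta> * cis s \<noteq> 0" for s
    using pos[of s] by force+
  have slit: "1 - \<alpha> * cis s \<notin> \<real>\<^sub>\<le>\<^sub>0" "1 - \<beta> * cis s \<notin> \<real>\<^sub>\<le>\<^sub>0" for s
    using pos[of s] by (auto simp: complex_nonpos_Reals_iff)
  have expL: "exp (L (cis s)) = (1 - \<alpha> * cis s) * (1 - \<beta> * cis s)" for s
    using nz[of s] by (simp add: L_def exp_add)
  have d\<Psi>: "\<exists>y. (\<Psi> has_field_derivative y) (at s) \<and> y > 0" for s
  proof -
    let ?w = "\<alpha> * cis s" and ?v = "\<beta> * cis s"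
    have "(L has_field_derivative (- \<alpha> / (1 - ?w) - \<beta> / (1 - ?v))) (at (cis s))"
      unfolding L_def by (rule derivative_eq_intros refl | simp add: slit nz field_simps)+
    from has_vector_derivative_comp_cis[OF this]
    have "((\<lambda>s. Im (L (cis s))) has_field_derivative
             Im (\<i> * cis s * (- \<alpha> / (1 - ?w) - \<beta> / (1 - ?v)))) (at s)"
      by (simp add: has_vector_derivative_complex_iff)
    from DERIV_add[OF DERIV_diff[OF DERIV_ident this] DERIV_const]
    have "(\<Psi> has_field_derivative
             (1 - Im (\<i> * cis s * (- \<alpha> / (1 - ?w) - \<beta> / (1 - ?v))))) (at s)"
      unfolding \<Psi>_def by (simp only: add_0_right)
    moreover have "\<i> * cis s * (- \<alpha> / (1 - ?w) - \<beta> / (1 - ?v)) = - \<i> * (?w / (1 - ?w) + ?v / (1 - ?v))"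
      by (simp add: algebra_simps add_divide_distrib)
    then have "1 - Im (\<i> * cis s * (- \<alpha> / (1 - ?w) - \<beta> / (1 - ?v)))
        = Re (1/2 + ?w / (1 - ?w)) + Re (1/2 + ?v / (1 - ?v))"
      by simp
    ultimately show ?thesis
      using Re_half_moebius_pos[OF small(1)[of s]] Re_half_moebius_pos[OF small(2)[of s]]
      by (metis add_pos_pos)
  qed
  have \<Psi>mono: "\<Psi> x < \<Psi> y" if "x < y" for x y
    using that d\<Psi> by (meson DERIV_pos_imp_increasing)
  have \<Psi>0: "\<Psi> 0 = 0" and \<Psi>2: "\<Psi> (2 * pi) = 2 * pi"
    by (simp_all add: \<Psi>_def)
  have cont\<Psi>: "continuous_on S \<Psi>" for S
    using d\<Psi> by (meson DERIV_isCont continuous_at_imp_continuous_on)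
  \<comment> \<open>At \<open>t0\<close> the tangent is antiparallel to the initial one. The
    derivative of \<open>g\<close> has the sign of \<open>- sin (\<Psi> s)\<close>, so this is where
    \<open>g\<close> stops decreasing and starts to increase.\<close>
  obtain t0 where t0: "0 \<le> t0" "t0 \<le> 2 * pi" "\<Psi> t0 = pi"
    using IVT'[of \<Psi> 0 pi "2 * pi"] \<Psi>0 \<Psi>2 cont\<Psi> by auto
  have dg: "(g has_field_derivative
      - (exp (Re (L 1) - Re (L (cis s))) * sin (\<Psi> s))) (at s)" for s
  proof -
    have "(H has_field_derivative 1 / exp (L (cis s))) (at (cis s))"
      using H[of "cis s"] by (simp add: expL)
    then have "((\<lambda>z. (H z - H 1) * exp (L 1)) has_field_derivative
        1 / exp (L (cis s)) * exp (L 1)) (at (cis s))"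
      by (auto intro!: derivative_eq_intros)
    from has_vector_derivative_comp_cis[OF this]
    have "((\<lambda>s. Re ((H (cis s) - H 1) * exp (L 1))) has_field_derivative
        Re (\<i> * cis s * (1 / exp (L (cis s)) * exp (L 1)))) (at s)"
      by (simp add: has_vector_derivative_complex_iff)
    moreover have "\<i> * cis s * (1 / exp (L (cis s)) * exp (L 1))
        = \<i> * exp (\<i> * s + L 1 - L (cis s))"
      by (simp add: exp_diff exp_add cis_conv_exp)
    moreover have "Re (\<i> * exp (\<i> * s + L 1 - L (cis s)))
        = - (exp (Re (L 1) - Re (L (cis s))) * sin (\<Psi> s))"
      by (simp add: Im_exp \<Psi>_def algebra_simps)
    moreover have "g = (\<lambda>s. Re ((H (cis s) - H 1) * exp (L 1)))"
      using expL[of 0] by (simp add: g_def fun_eq_iff)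
    ultimately show ?thesis by metis
  qed
  have contg: "continuous_on S g" for S
    using dg by (meson DERIV_isCont continuous_at_imp_continuous_on)
  have g0: "g 0 = 0" "g (2 * pi) = 0" by (simp_all add: g_def)
  have "g t < 0"
  proof (cases "t \<le> t0")
    case True
    have "g t < g 0"
    proof (rule DERIV_neg_imp_decreasing_open[OF t(1) _ contg])
      fix x assume x: "0 < x" "x < t"
      then have "0 < \<Psi> x" "\<Psi> x < pi"
        using \<Psi>mono[of 0 x] \<Psi>mono[of x t0] \<Psi>0 t0 True by auto
      then have "sin (\<Psi> x) > 0" by (rule sin_gt_zero)
      then show "\<exists>y. (g has_real_derivative y) (at x) \<and> y < 0"
        using dg[of x] by (intro exI conjI) auto
    qed
    then show ?thesis using g0 by simp
  next
    case False
    have "g t < g (2 * pi)"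
    proof (rule DERIV_pos_imp_increasing_open[OF t(2) _ contg])
      fix x assume x: "t < x" "x < 2 * pi"
      then have "pi < \<Psi> x" "\<Psi> x < 2 * pi"
        using \<Psi>mono[of t0 x] \<Psi>mono[of x "2*pi"] \<Psi>2 t0 False by auto
      then have "sin (\<Psi> x) < 0" by (rule sin_lt_zero)
      then show "\<exists>y. (g has_real_derivative y) (at x) \<and> y > 0"
        using dg[of x] by (intro exI conjI) (auto simp: mult_pos_neg)
    qed
    then show ?thesis using g0 by simp
  qed
  then show ?thesis by (simp add: g_def)
qed

text \<open>The maximum principle carries the inequality from the circle to the interior. It stays
  strict there because the derivative of \<open>k\<close> has no zero, so \<open>k\<close> cannot be
  constant.\<close>

lemma disc_below_tangent:
  fixes H :: "complex \<Rightarrow> complex" and \<alpha> \<beta> z :: complex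
  assumes \<alpha>: "norm \<alpha> < 1" and \<beta>: "norm \<beta> < 1"
    and H: "\<And>z. norm z \<le> 1 \<Longrightarrow> (H has_field_derivative 1 / ((1 - \<alpha>*z) * (1 - \<beta>*z))) (at z)"
    and z: "norm z \<le> 1" "z \<noteq> 1"
  shows "Re ((H z - H 1) * ((1 - \<alpha>) * (1 - \<beta>))) < 0"
proof -
  define k where "k w = (H w - H 1) * ((1 - \<alpha>) * (1 - \<beta>))" for w
  have circ: "Re (k w) < 0" if "norm w = 1" "w \<noteq> 1" for w
  proof -
    obtain t where t: "w = cis t" "0 \<le> t" "t < 2 * pi"
      using \<open>norm w = 1\<close> Arg2pi[of w] by (intro that[of "Arg2pi w"]) (auto simp: cis_conv_exp is_Arg_def)
    with that have "t > 0" by (cases "t = 0") auto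
    then show ?thesis
      using circle_below_tangent[OF \<alpha> \<beta> H] t by (simp add: k_def)
  qed
  have dk: "(k has_field_derivative ((1 - \<alpha>) * (1 - \<beta>)) / ((1 - \<alpha>*w) * (1 - \<beta>*w))) (at w)"
    if "norm w \<le> 1" for w
    unfolding k_def using H[OF that] by (auto intro!: derivative_eq_intros)
  have holk: "k holomorphic_on ball 0 1"
    by (subst holomorphic_on_open) (auto intro!: exI dk)
  have contk: "continuous_on (cball 0 1) k"
    using dk by (auto intro!: continuous_at_imp_continuous_on DERIV_isCont)
  have le: "Re (k w) \<le> 0" if "norm w \<le> 1" for w
  proof (rule maximum_real_frontier[of k "cball 0 1"])
    fix v :: complex assume "v \<in> frontier (cball 0 1)"
    then have "norm v = 1" by (simp add: frontier_cball)
    then show "Re (k v) \<le> 0" using circ[of v] by (cases "v = 1") (auto simp: k_def)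
  qed (use holk contk that in auto)
  have "Re (k z) < 0"
  proof (cases "norm z = 1")
    case True then show ?thesis using circ z by blast
  next
    case False
    then have zb: "z \<in> ball 0 1" using z by simp
    show ?thesis
    proof (rule ccontr)
      assume "\<not> Re (k z) < 0"
      then have k0: "Re (k z) = 0" using le[of z] z by simp
      \<comment> \<open>The modulus of \<open>exp (k w)\<close> is \<open>exp (Re (k w))\<close>,
        hence at most 1, so a zero of \<open>Re (k w)\<close> inside the disc would be an interior
        maximum of the modulus.\<close>
      have "(\<lambda>w. exp (k w)) constant_on ball 0 1"
      proof (rule maximum_modulus_principle[where U = "ball 0 1" and \<xi> = z])
        show "(\<lambda>w. exp (k w)) holomorphic_on ball 0 1"
          using holk by (intro holomorphic_intros)
      qed (use zb k0 le in auto)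
      then obtain y where y: "\<And>w. w \<in> ball 0 1 \<Longrightarrow> exp (k w) = y"
        by (auto simp: constant_on_def)
      have "((\<lambda>w. exp (k w)) has_field_derivative 0) (at z)"
        by (rule has_field_derivative_transform_within_open[of "\<lambda>_. y" _ _ "ball 0 1"])
           (use y zb in auto)
      moreover have "((\<lambda>w. exp (k w)) has_field_derivative
          exp (k z) * (((1 - \<alpha>) * (1 - \<beta>)) / ((1 - \<alpha>*z) * (1 - \<beta>*z)))) (at z)"
        using dk[of z] z by (auto intro!: derivative_eq_intros)
      ultimately have "exp (k z) * (((1 - \<alpha>) * (1 - \<beta>)) / ((1 - \<alpha>*z) * (1 - \<beta>*z))) = 0"
        by (rule DERIV_unique[symmetric])
      moreover have "norm (\<alpha> * z) < 1" "norm (\<beta> * z) < 1"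
        using \<alpha> \<beta> z mult_le_one[of "norm z"] by (simp_all add: norm_mult)
           (metis mult_left_le le_less_trans norm_ge_zero)+
      ultimately show False using \<alpha> \<beta> by auto
    qed
  qed
  then show ?thesis by (simp add: k_def)
qed

text \<open>The instance at radius \<open>norm \<zeta>\<close> follows from the one at the point \<open>1\<close> by rescaling, so
  that injectivity comes for free.\<close>

lemma image_below_tangent:
  fixes F :: "complex \<Rightarrow> complex" and \<alpha> \<beta> z \<zeta> :: complex and c R :: real
  assumes c: "c > 0" and \<alpha>: "norm \<alpha> * R \<le> 1" and \<beta>: "norm \<beta> * R \<le> 1"
    and F: "\<And>z. norm z < R \<Longrightarrow> (F has_field_derivative c / ((1 - \<alpha>*z) * (1 - \<beta>*z))) (at z)"
    and z: "norm z \<le> norm \<zeta>" "norm \<zeta> < R" "z \<noteq> \<zeta>"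
  shows "Re ((F z - F \<zeta>) * ((1 - \<alpha>*\<zeta>) * (1 - \<beta>*\<zeta>) / \<zeta>)) < 0"
proof -
  have \<zeta>0: "\<zeta> \<noteq> 0" using z by auto
  define H where "H w = F (\<zeta> * w) / (\<zeta> * c)" for w
  have "Re ((H (z / \<zeta>) - H 1) * ((1 - \<alpha>*\<zeta>) * (1 - \<beta>*\<zeta>))) < 0"
  proof (rule disc_below_tangent)
    show "norm (\<alpha> * \<zeta>) < 1" "norm (\<beta> * \<zeta>) < 1" using \<alpha> \<beta> z(2) by (auto intro: norm_mult_less_1)
    show "norm (z / \<zeta>) \<le> 1" using z by (simp add: norm_divide divide_le_eq_1)
    show "z / \<zeta> \<noteq> 1" using z by auto
    fix w :: complex assume "norm w \<le> 1"
    then have "norm (\<zeta> * w) < R"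
      using z mult_left_le[of "norm w" "norm \<zeta>"] by (simp add: norm_mult)
    from F[OF this] have "(F has_field_derivative c / ((1 - \<alpha>*(\<zeta>*w)) * (1 - \<beta>*(\<zeta>*w)))) (at (\<zeta> * w))" .
    from DERIV_chain2[where g = "\<lambda>w. \<zeta> * w" and x = w and s = UNIV and Db = \<zeta>, OF this]
    have "((\<lambda>w. F (\<zeta> * w)) has_field_derivative c / ((1 - \<alpha>*(\<zeta>*w)) * (1 - \<beta>*(\<zeta>*w))) * \<zeta>) (at w)"
      by (auto intro!: derivative_eq_intros)
    from DERIV_cdivide[OF this, of "\<zeta> * c"]
    show "(H has_field_derivative 1 / ((1 - \<alpha>*\<zeta>*w) * (1 - \<beta>*\<zeta>*w))) (at w)"
      using \<zeta>0 c by (simp add: H_def[abs_def] mult.assoc)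
  qed
  moreover have "(H (z / \<zeta>) - H 1) * ((1 - \<alpha>*\<zeta>) * (1 - \<beta>*\<zeta>))
     = (F z - F \<zeta>) * ((1 - \<alpha>*\<zeta>) * (1 - \<beta>*\<zeta>) / \<zeta>) / of_real c"
    using \<zeta>0 c by (simp add: H_def field_simps)
  ultimately show ?thesis
    using c by (simp only: Re_divide_of_real) (simp add: divide_less_0_iff)
qed

section \<open>Harmonic maps of the disc\<close>

text \<open>The second difference is the increment over \<open>0 \<le> t \<le> 1\<close> of the
  difference of \<open>f\<close> along two parallel segments in direction \<open>u\<close>. The mean
  value inequality applies to it, and differentiability of \<open>Df\<close> at \<open>z\<close>
  makes its derivative \<open>(s * s) *\<^sub>R D2 v\<close> up to a small multiple of
  \<open>s * s\<close>.\<close>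

lemma second_difference_bound:
  fixes f :: "'a::real_normed_vector \<Rightarrow> 'b::real_normed_vector"
  assumes S: "open S" "z \<in> S"
    and f: "\<And>w. w \<in> S \<Longrightarrow> (f has_derivative Df w) (at w)"
    and D2: "((\<lambda>w. Df w u) has_derivative D2) (at z)"
    and e: "e > 0"
  shows "\<exists>d>0. \<forall>s. 0 < s \<and> s < d \<longrightarrow>
    norm (f (z + s *\<^sub>R u + s *\<^sub>R v) - f (z + s *\<^sub>R u) - f (z + s *\<^sub>R v) + f z - (s * s) *\<^sub>R D2 v)
      \<le> e * (s * s)"
proof -
  define B where "B = norm u + norm v + 1"
  have B: "B > 0" by (simp add: B_def add_nonneg_pos)
  interpret D2: bounded_linear D2 using D2 by (rule has_derivative_bounded_linear)
  \<comment> \<open>All points involved lie within \<open>s * B\<close> of \<open>z\<close>. Two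
    errors of size \<open>e' * (s * B)\<close>, multiplied by the factor \<open>s\<close> from the
    chain rule, add up to \<open>e * (s * s)\<close>.\<close>
  define e' where "e' = e / (2 * B)"
  have e': "e' > 0" using e B by (simp add: e'_def)
  obtain r where r: "r > 0" "ball z r \<subseteq> S" using S by (meson open_contains_ball)
  obtain d where d: "d > 0"
    "\<And>y. norm (y - z) < d \<Longrightarrow> norm (Df y u - Df z u - D2 (y - z)) \<le> e' * norm (y - z)"
    using D2 e' unfolding has_derivative_at_alt by metis
  have "norm (f (z + s *\<^sub>R u + s *\<^sub>R v) - f (z + s *\<^sub>R u) - f (z + s *\<^sub>R v) + f z - (s * s) *\<^sub>R D2 v)
      \<le> e * (s * s)" if s: "0 < s" "s < min d r / B" for s
  proof -
    have sB: "s * B < d" "s * B < r" using s B by (simp_all add: pos_less_divide_eq)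
    define y1 where "y1 t = z + (t * s) *\<^sub>R u + s *\<^sub>R v" for t
    define y2 where "y2 t = z + (t * s) *\<^sub>R u" for t
    define \<phi> where "\<phi> t = f (y1 t) - f (y2 t) - t *\<^sub>R ((s * s) *\<^sub>R D2 v)" for t
    define \<phi>' where "\<phi>' t = Df (y1 t) (s *\<^sub>R u) - Df (y2 t) (s *\<^sub>R u) - (s * s) *\<^sub>R D2 v" for t
    have n1: "norm (y1 t - z) \<le> s * B" "norm (y2 t - z) \<le> s * B" if "0 \<le> t" "t \<le> 1" for t
    proof -
      have "t * s * norm u \<le> s * norm u" using that s by (simp add: mult_left_le_one_le mult_right_mono)
      moreover have "norm ((t * s) *\<^sub>R u + s *\<^sub>R v) \<le> t * s * norm u + s * norm v"
        using that s by (intro order_trans[OF norm_triangle_ineq]) simp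
      moreover have "0 \<le> s * norm v" "s * B = s * norm u + s * norm v + s"
        using s by (simp_all add: B_def distrib_left)
      moreover have "norm (y1 t - z) = norm ((t * s) *\<^sub>R u + s *\<^sub>R v)" "norm (y2 t - z) = t * s * norm u"
        using that s by (simp_all add: y1_def y2_def)
      ultimately have "norm (y1 t - z) \<le> s * B \<and> norm (y2 t - z) \<le> s * B"
        using s by linarith
      then show "norm (y1 t - z) \<le> s * B" "norm (y2 t - z) \<le> s * B" by auto
    qed
    have d\<phi>: "(\<phi> has_vector_derivative \<phi>' t) (at t)" if t: "0 \<le> t" "t \<le> 1" for t
    proof -
      have "y1 t \<in> S" "y2 t \<in> S"
        using n1[OF t] sB r(2) by (auto simp: dist_norm norm_minus_commute subset_iff)
      then have F: "(f has_derivative Df (y1 t)) (at (y1 t))" "(f has_derivative Df (y2 t)) (at (y2 t))"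
        using f by auto
      have Y: "(y1 has_vector_derivative s *\<^sub>R u) (at t)" "(y2 has_vector_derivative s *\<^sub>R u) (at t)"
        unfolding y1_def y2_def has_vector_derivative_def
        by (auto intro!: derivative_eq_intros simp: fun_eq_iff)
      have "((\<lambda>t. f (y1 t)) has_vector_derivative Df (y1 t) (s *\<^sub>R u)) (at t)"
        "((\<lambda>t. f (y2 t)) has_vector_derivative Df (y2 t) (s *\<^sub>R u)) (at t)"
        using vector_derivative_diff_chain_within[OF Y(1), of f "Df (y1 t)"]
          vector_derivative_diff_chain_within[OF Y(2), of f "Df (y2 t)"] F
        by (auto simp: o_def intro: has_derivative_at_withinI)
      then show ?thesis
        unfolding \<phi>_def \<phi>'_def
        by (intro has_vector_derivative_diff) (auto intro!: derivative_eq_intros simp: has_vector_derivative_def)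
    qed
    have bound: "norm (\<phi>' t) \<le> e * (s * s)" if t: "0 \<le> t" "t \<le> 1" for t
    proof -
      have "y1 t \<in> S" "y2 t \<in> S"
        using n1[OF t] sB r(2) by (auto simp: dist_norm norm_minus_commute subset_iff)
      then have "bounded_linear (Df (y1 t))" "bounded_linear (Df (y2 t))"
        using f has_derivative_bounded_linear by blast+
      then have lin: "Df (y1 t) (s *\<^sub>R u) = s *\<^sub>R Df (y1 t) u" "Df (y2 t) (s *\<^sub>R u) = s *\<^sub>R Df (y2 t) u"
        by (simp_all add: linear_simps)
      have "D2 (y1 t - z) - D2 (y2 t - z) = s *\<^sub>R D2 v"
        by (simp add: y1_def y2_def D2.add D2.scaleR)
      then have "\<phi>' t = s *\<^sub>R ((Df (y1 t) u - Df z u - D2 (y1 t - z)) - (Df (y2 t) u - Df z u - D2 (y2 t - z)))"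
        by (simp add: \<phi>'_def lin algebra_simps)
      then have "norm (\<phi>' t) = s * norm ((Df (y1 t) u - Df z u - D2 (y1 t - z)) - (Df (y2 t) u - Df z u - D2 (y2 t - z)))"
        using s by simp
      also have "\<dots> \<le> s * (e' * (s * B) + e' * (s * B))"
      proof (rule mult_left_mono[OF order_trans[OF norm_triangle_ineq4 add_mono]])
        show "norm (Df (y1 t) u - Df z u - D2 (y1 t - z)) \<le> e' * (s * B)"
          using d(2)[of "y1 t"] n1(1)[OF t] sB e' by (smt (verit) mult_left_mono)
        show "norm (Df (y2 t) u - Df z u - D2 (y2 t - z)) \<le> e' * (s * B)"
          using d(2)[of "y2 t"] n1(2)[OF t] sB e' by (smt (verit) mult_left_mono)
      qed (use s in auto)
      also have "\<dots> = e * (s * s)" using B by (simp add: e'_def field_simps)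
      finally show ?thesis .
    qed
    have "norm (\<phi> 1 - \<phi> 0) \<le> e * (s * s) * 1 - e * (s * s) * 0"
    proof (rule differentiable_bound_general[where f' = \<phi>' and \<phi>' = "\<lambda>_. e * (s * s)"])
      show "continuous_on {0..1} \<phi>"
        using d\<phi> by (intro continuous_at_imp_continuous_on ballI has_vector_derivative_continuous) auto
      show "((*) (e * (s * s)) has_vector_derivative e * (s * s)) (at x)" for x
        by (auto simp: has_vector_derivative_def intro!: derivative_eq_intros)
    qed (use d\<phi> bound in \<open>auto intro!: continuous_intros\<close>)
    then show ?thesis by (simp add: \<phi>_def y1_def y2_def algebra_simps)
  qed
  moreover have "min d r / B > 0" using d(1) r(1) B by simp
  ultimately show ?thesis by blast
qed

text \<open>The second difference is symmetric in \<open>u\<close> and \<open>v\<close> and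
  approximates both sides after scaling by \<open>s * s\<close>. Equality of the mixed derivatives
  is half of the Cauchy-Riemann equations in the decomposition of harmonic maps.\<close>

lemma second_derivative_symmetric:
  fixes f :: "'a::real_normed_vector \<Rightarrow> 'b::real_normed_vector"
  assumes S: "open S" "z \<in> S"
    and f: "\<And>w. w \<in> S \<Longrightarrow> (f has_derivative Df w) (at w)"
    and D2: "\<And>u. ((\<lambda>w. Df w u) has_derivative D2 u) (at z)"
  shows "D2 u v = D2 v u"
proof (rule ccontr)
  assume "D2 u v \<noteq> D2 v u"
  \<comment> \<open>With a quarter of the gap, the two errors together cover only half of it, which
    is the contradiction.\<close>
  define e where "e = norm (D2 u v - D2 v u) / 4"
  have e: "e > 0" using \<open>D2 u v \<noteq> D2 v u\<close> by (simp add: e_def)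
  let ?d = "\<lambda>s u v. f (z + s *\<^sub>R u + s *\<^sub>R v) - f (z + s *\<^sub>R u) - f (z + s *\<^sub>R v) + f z"
  obtain d1 where d1: "d1 > 0"
    "\<And>s. 0 < s \<Longrightarrow> s < d1 \<Longrightarrow> norm (?d s u v - (s * s) *\<^sub>R D2 u v) \<le> e * (s * s)"
    using second_difference_bound[OF S f D2[of u] e, of v] by blast
  obtain d2 where d2: "d2 > 0"
    "\<And>s. 0 < s \<Longrightarrow> s < d2 \<Longrightarrow> norm (?d s v u - (s * s) *\<^sub>R D2 v u) \<le> e * (s * s)"
    using second_difference_bound[OF S f D2[of v] e, of u] by blast
  define s where "s = min d1 d2 / 2"
  have s: "0 < s" "s < d1" "s < d2" using d1(1) d2(1) by (auto simp: s_def)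
  have sym: "?d s v u = ?d s u v" by (simp add: algebra_simps)
  have "(s * s) * norm (D2 u v - D2 v u) = norm ((s * s) *\<^sub>R (D2 u v - D2 v u))"
    using s by simp
  also have "\<dots> = norm ((?d s v u - (s * s) *\<^sub>R D2 v u) - (?d s u v - (s * s) *\<^sub>R D2 u v))"
    unfolding sym by (simp add: scaleR_diff_right)
  also have "\<dots> \<le> e * (s * s) + e * (s * s)"
    by (rule order_trans[OF norm_triangle_ineq4 add_mono[OF d2(2)[OF s(1,3)] d1(2)[OF s(1,2)]]])
  also have "\<dots> = (s * s) * (norm (D2 u v - D2 v u) / 2)" by (simp add: e_def)
  finally have "norm (D2 u v - D2 v u) \<le> norm (D2 u v - D2 v u) / 2"
    using s by (subst (asm) mult_le_cancel_left_pos) auto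
  then show False using \<open>D2 u v \<noteq> D2 v u\<close> by simp
qed

lemma bounded_linear_complex_eq:
  assumes "bounded_linear L"
  shows "L v = Re v *\<^sub>R L 1 + Im v *\<^sub>R L \<i>"
proof -
  interpret bounded_linear L by fact
  have "v = Re v *\<^sub>R 1 + Im v *\<^sub>R \<i>" by (simp add: complex_eq_iff)
  then have "L v = L (Re v *\<^sub>R 1 + Im v *\<^sub>R \<i>)" by simp
  then show ?thesis by (simp only: add scaleR)
qed

text \<open>The second hypothesis is the Cauchy-Riemann equation: a real-linear map commuting with
  \<i> on the basis vector 1 is multiplication by its value there.\<close>

lemma has_derivative_complex_linear:
  assumes "(f has_derivative L) F" "L \<i> = \<i> * L 1"
  shows "(f has_field_derivative L 1) F"
proof -
  have "L v = L 1 * v" for v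
    using bounded_linear_complex_eq[OF has_derivative_bounded_linear[OF assms(1)], of v] assms(2)
    by (simp add: complex_eq_iff)
  then have "L = (\<lambda>v. L 1 * v)" by blast
  then show ?thesis using assms(1) unfolding has_field_derivative_def by metis
qed

text \<open>The Laplace equation together with the symmetry of the mixed derivatives says that
  \<open>f_z\<close> and the conjugate of \<open>f_zbar\<close> are holomorphic. On the convex disc
  they have primitives, which are the two parts of \<open>f\<close>.\<close>

lemma harmonic_decomposition:
  assumes harm: "harmonic_on f (ball 0 1)" and f0: "f 0 = 0"
  obtains H G where "H holomorphic_on ball 0 1" "G holomorphic_on ball 0 1" "H 0 = 0" "G 0 = 0"
    "\<And>z. z \<in> ball 0 1 \<Longrightarrow> f z = H z + cnj (G z)"
proof -
  let ?B = "ball 0 1 :: complex set"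
  from harm obtain Df D2f where
    Df: "\<And>z. z \<in> ?B \<Longrightarrow> (f has_derivative Df z) (at z)" and
    D2: "\<And>z u. z \<in> ?B \<Longrightarrow> ((\<lambda>w. Df w u) has_derivative D2f z u) (at z)" and
    lap: "\<And>z. z \<in> ?B \<Longrightarrow> D2f z 1 1 + D2f z \<i> \<i> = 0"
    unfolding harmonic_on_def by blast
  have sym: "D2f z 1 \<i> = D2f z \<i> 1" if "z \<in> ?B" for z
    by (rule second_derivative_symmetric[OF open_ball that Df D2[OF that]])
  have lap': "D2f z \<i> \<i> = - D2f z 1 1" if "z \<in> ?B" for z
    using lap[OF that] by (simp add: eq_neg_iff_add_eq_0 add.commute)
  \<comment> \<open>These are the Wirtinger derivatives: \<open>h\<close> is \<open>f_z\<close>, and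
    \<open>k\<close> is the conjugate of \<open>f_zbar\<close>.\<close>
  define h where "h z = 1/2 * (Df z 1 - \<i> * Df z \<i>)" for z
  define k where "k z = cnj (1/2 * (Df z 1 + \<i> * Df z \<i>))" for z
  have hol_h: "h holomorphic_on ?B"
  proof (subst holomorphic_on_open)
    have "(h has_field_derivative 1/2 * (D2f z 1 1 - \<i> * D2f z \<i> 1)) (at z)" if "z \<in> ?B" for z
    proof -
      have "(h has_derivative (\<lambda>v. 1/2 * (D2f z 1 v - \<i> * D2f z \<i> v))) (at z)"
        unfolding h_def
        by (intro has_derivative_diff has_derivative_mult_right D2[OF that])
      then show ?thesis
        by (rule has_derivative_complex_linear) (use sym[OF that] lap'[OF that] in \<open>simp add: algebra_simps\<close>)
    qed
    then show "\<forall>x\<in>?B. \<exists>f'. (h has_field_derivative f') (at x)" by blast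
  qed simp
  have hol_k: "k holomorphic_on ?B"
  proof (subst holomorphic_on_open)
    have "(k has_field_derivative cnj (1/2 * (D2f z 1 1 + \<i> * D2f z \<i> 1))) (at z)" if "z \<in> ?B" for z
    proof -
      have "(k has_derivative (\<lambda>v. cnj (1/2 * (D2f z 1 v + \<i> * D2f z \<i> v)))) (at z)"
        unfolding k_def
        by (intro has_derivative_cnj has_derivative_add has_derivative_mult_right D2[OF that])
      then show ?thesis
        by (rule has_derivative_complex_linear) (use sym[OF that] lap'[OF that] in \<open>simp add: algebra_simps\<close>)
    qed
    then show "\<forall>x\<in>?B. \<exists>f'. (k has_field_derivative f') (at x)" by blast
  qed simp
  obtain H0 where H0: "\<And>z. z \<in> ?B \<Longrightarrow> (H0 has_field_derivative h z) (at z within ?B)"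
    using holomorphic_convex_primitive'[OF convex_ball open_ball hol_h] by blast
  obtain G0 where G0: "\<And>z. z \<in> ?B \<Longrightarrow> (G0 has_field_derivative k z) (at z within ?B)"
    using holomorphic_convex_primitive'[OF convex_ball open_ball hol_k] by blast
  define H where "H z = H0 z - H0 0" for z
  define G where "G z = G0 z - G0 0" for z
  have H': "(H has_field_derivative h z) (at z)" if "z \<in> ?B" for z
    using DERIV_diff[OF H0[OF that] DERIV_const[of "H0 0"]]
    unfolding H_def[abs_def] at_within_open[OF that open_ball] by simp
  have G': "(G has_field_derivative k z) (at z)" if "z \<in> ?B" for z
    using DERIV_diff[OF G0[OF that] DERIV_const[of "G0 0"]]
    unfolding G_def[abs_def] at_within_open[OF that open_ball] by simp
  have "((\<lambda>z. f z - (H z + cnj (G z))) has_derivative (\<lambda>v. 0)) (at z within ?B)" if "z \<in> ?B" for z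
  proof -
    have "((\<lambda>z. f z - (H z + cnj (G z))) has_derivative (\<lambda>v. Df z v - (h z * v + cnj (k z * v)))) (at z)"
      using H'[OF that] G'[OF that]
      by (intro has_derivative_diff has_derivative_add has_derivative_cnj Df[OF that])
         (simp_all add: has_field_derivative_def)
    moreover have "Df z v - (h z * v + cnj (k z * v)) = 0" for v
      using bounded_linear_complex_eq[OF has_derivative_bounded_linear[OF Df[OF that]], of v]
      by (simp add: h_def k_def complex_eq_iff field_simps)
    ultimately show ?thesis by (simp add: has_derivative_at_withinI)
  qed
  then obtain C where C: "\<forall>z\<in>?B. f z - (H z + cnj (G z)) = C"
    using has_derivative_zero_constant[OF convex_ball, of 0 1 "\<lambda>z. f z - (H z + cnj (G z))"] by blast
  have "C = 0" using C[rule_format, of 0] f0 by (simp add: H_def G_def)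
  then have "f z = H z + cnj (G z)" if "z \<in> ?B" for z using C that by auto
  moreover have "H holomorphic_on ?B" "G holomorphic_on ?B"
    unfolding holomorphic_on_open[OF open_ball] using H' G' by blast+
  ultimately show ?thesis using that[of H G] by (simp add: H_def G_def)
qed

lemma harmonic_on_holomorphic_plus_cnj:
  assumes H: "H holomorphic_on S" and G: "G holomorphic_on S" and S: "open S"
    and f: "\<And>z. z \<in> S \<Longrightarrow> f z = H z + cnj (G z)"
  shows "harmonic_on f S"
    and "\<And>z. z \<in> S \<Longrightarrow> (f has_derivative (\<lambda>v. deriv H z * v + cnj (deriv G z * v))) (at z)"
proof -
  define Df where "Df z v = deriv H z * v + cnj (deriv G z * v)" for z v
  define D2f where "D2f z u v = deriv (deriv H) z * v * u + cnj (deriv (deriv G) z * v * u)" for z u v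
  have hol: "deriv H holomorphic_on S" "deriv G holomorphic_on S"
    using H G S by (auto intro: holomorphic_deriv)
  then have hol2: "deriv (deriv H) holomorphic_on S" "deriv (deriv G) holomorphic_on S"
    using S by (auto intro: holomorphic_deriv)
  have D: "(K has_derivative (\<lambda>v. deriv K z * v)) (at z)" if "K holomorphic_on S" "z \<in> S" for K z
    using holomorphic_derivI[OF that(1) S that(2)] by (simp add: has_field_derivative_def)
  have 1: "(f has_derivative Df z) (at z)" if "z \<in> S" for z
  proof (rule has_derivative_transform_within_open[OF _ S that])
    show "((\<lambda>z. H z + cnj (G z)) has_derivative Df z) (at z)"
      unfolding Df_def by (intro has_derivative_add has_derivative_cnj D H G that)
  qed (use f in simp)
  then show "\<And>z. z \<in> S \<Longrightarrow> (f has_derivative (\<lambda>v. deriv H z * v + cnj (deriv G z * v))) (at z)"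
    by (simp add: Df_def[abs_def])
  have 2: "((\<lambda>w. Df w u) has_derivative D2f z u) (at z)" if "z \<in> S" for z u
    unfolding Df_def D2f_def
    by (intro has_derivative_add has_derivative_cnj has_derivative_mult_left D hol that)
  have 3: "continuous_on S (\<lambda>w. D2f w u v)" for u v
    unfolding D2f_def
    by (intro continuous_intros hol2[THEN holomorphic_on_imp_continuous_on])
  have 4: "D2f z 1 1 + D2f z \<i> \<i> = 0" for z by (simp add: D2f_def mult.assoc)
  show "harmonic_on f S"
    unfolding harmonic_on_def using S 1 2 3 4 by blast
qed

section \<open>Conformal real-linear maps of the plane\<close>

lemma conformal_linear_norm:
  assumes "conformal_linear L"
  obtains m where "\<And>v. norm (L v) = m * norm v"
proof -
  obtain m T where T: "m \<ge> 0" "orthogonal_transformation T" "L = (\<lambda>h. m *\<^sub>R T h)"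
    using assms unfolding conformal_linear_def by blast
  then have "norm (L v) = m * norm v" for v
    by (simp add: orthogonal_transformation_norm)
  then show ?thesis using that by blast
qed

text \<open>For unit \<open>v\<close>, the squared length of \<open>A v + cnj (B v)\<close> is \<open>\<bar>A\<bar>\<^sup>2 + \<bar>B\<bar>\<^sup>2 + 2 Re (A B v\<^sup>2)\<close>.\<close>

lemma conformal_linear_imp_zero:
  assumes "conformal_linear (\<lambda>v. A * v + cnj (B * v))"
  shows "A = 0 \<or> B = 0"
proof -
  obtain m where m: "\<And>v. norm (A * v + cnj (B * v)) = m * norm v"
    using conformal_linear_norm[OF assms] by blast
  have sq: "(norm (A * v + cnj (B * v)))\<^sup>2 = ((norm A)\<^sup>2 + (norm B)\<^sup>2) * (norm v)\<^sup>2 + 2 * Re (A * B * v\<^sup>2)" for v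
    unfolding cmod_power2 by (simp add: algebra_simps power2_eq_square)
  \<comment> \<open>The squares of 1 and \<i> are opposite, which isolates
    \<open>Re (A * B)\<close>. The vectors \<open>1 + \<i>\<close> and \<open>1 - \<i>\<close> have
    equal length and squares \<open>2 * \<i>\<close> and \<open>- 2 * \<i>\<close>, which isolates
    \<open>Im (A * B)\<close>.\<close>
  have "(norm (A * 1 + cnj (B * 1)))\<^sup>2 = (norm (A * \<i> + cnj (B * \<i>)))\<^sup>2"
    unfolding m by simp
  then have re: "Re (A * B) = 0" unfolding sq by simp
  have nn: "norm (1 + \<i>) = norm (1 - \<i>)" by (simp add: cmod_def)
  have "(norm (A * (1 + \<i>) + cnj (B * (1 + \<i>))))\<^sup>2 = (norm (A * (1 - \<i>) + cnj (B * (1 - \<i>))))\<^sup>2"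
    unfolding m nn ..
  then have "Re (A * B * (1 + \<i>)\<^sup>2) = Re (A * B * (1 - \<i>)\<^sup>2)" unfolding sq nn by simp
  moreover have "(1 + \<i>)\<^sup>2 = 2 * \<i>" "(1 - \<i>)\<^sup>2 = - 2 * \<i>"
    by (simp_all add: power2_eq_square algebra_simps)
  ultimately have "Im (A * B) = 0" by (simp add: algebra_simps)
  with re have "A * B = 0" by (simp only: complex_eq_iff zero_complex.sel simp_thms)
  then show ?thesis by simp
qed

lemma conformal_linear_scaling:
  assumes L: "linear L" and n: "\<And>v. norm (L v) = m * norm v" and m: "m > 0"
  shows "conformal_linear L"
proof -
  have "orthogonal_transformation (\<lambda>v. (1 / m) *\<^sub>R L v)"
    unfolding orthogonal_transformation
    using L n m by (auto intro: linear_compose_scale_right)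
  moreover have "L = (\<lambda>v. m *\<^sub>R ((1 / m) *\<^sub>R L v))" using m by simp
  ultimately show ?thesis unfolding conformal_linear_def using m less_imp_le by blast
qed

lemma onorm_scaling:
  fixes L :: "complex \<Rightarrow> complex"
  assumes L: "bounded_linear L" and n: "\<And>v. norm (L v) = m * norm v"
  shows "onorm L = m"
proof (rule antisym)
  have m: "m \<ge> 0" using n[of 1] by (metis mult.right_neutral norm_ge_zero norm_one)
  show "onorm L \<le> m" using n m by (intro onorm_bound) auto
  have "norm (L 1) / norm (1::complex) \<le> onorm L"
    by (rule le_onorm[OF L])
  then show "m \<le> onorm L" using n by simp
qed

section \<open>Fourier coefficients on circles\<close>

text \<open>This is Cauchy's formula for the n-th derivative: with
  \<open>u = r * cis (2*pi*t)\<close>, the form \<open>du / u ^ Suc n\<close> becomes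
  \<open>2 * pi * \<i> / r ^ n * cnj (cis (2*pi*t)) ^ n dt\<close>.\<close>

lemma has_integral_circle_coeff:
  fixes H :: "complex \<Rightarrow> complex" and r R :: real
  assumes H: "H holomorphic_on ball 0 R" and r: "0 < r" "r < R"
  shows "((\<lambda>t. H (r * cis (2*pi*t)) * cnj (cis (2*pi*t)) ^ n) has_integral
           r ^ n * ((deriv ^^ n) H 0 / fact n)) {0..1}"
proof -
  have sub: "cball (0::complex) r \<subseteq> ball 0 R" "ball (0::complex) r \<subseteq> ball 0 R" using r by auto
  have "((\<lambda>u. H u / (u - 0) ^ Suc n) has_contour_integral (2 * pi * \<i> / fact n * (deriv ^^ n) H 0)) (circlepath 0 r)"
    using r by (intro Cauchy_has_contour_integral_higher_derivative_circlepath
        holomorphic_on_imp_continuous_on holomorphic_on_subset[OF H] sub) auto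
  then have "((\<lambda>t. H (r * cis (2*pi*t)) / (r * cis (2*pi*t)) ^ Suc n * (2 * pi * \<i> * r * cis (2*pi*t)))
      has_integral (2 * pi * \<i> / fact n * (deriv ^^ n) H 0)) {0..1}"
    unfolding has_contour_integral_def
    by (rule has_integral_eq[rotated])
       (simp add: vector_derivative_circlepath01, simp add: circlepath cis_conv_exp mult_ac)
  from has_integral_mult_right[OF this, of "r ^ n / (2 * pi * \<i>)"]
  have *: "((\<lambda>t. r ^ n / (2 * pi * \<i>) * (H (r * cis (2*pi*t)) / (r * cis (2*pi*t)) ^ Suc n * (2 * pi * \<i> * r * cis (2*pi*t))))
      has_integral r ^ n * ((deriv ^^ n) H 0 / fact n)) {0..1}"
    by (simp add: field_simps)
  show ?thesis
  proof (rule has_integral_eq[OF _ *])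
    fix t :: real
    define w where "w = cis (2*pi*t)"
    have "w * cnj w = 1" by (simp add: w_def complex_norm_square[symmetric])
    then have "w ^ n * cnj w ^ n = 1" "w \<noteq> 0" by (auto simp flip: power_mult_distrib)
    then show "r ^ n / (2 * pi * \<i>) * (H (r * cis (2*pi*t)) / (r * cis (2*pi*t)) ^ Suc n * (2 * pi * \<i> * r * cis (2*pi*t)))
        = H (r * cis (2*pi*t)) * cnj (cis (2*pi*t)) ^ n"
      unfolding w_def[symmetric] using r by (simp add: power_mult_distrib field_simps)
  qed
qed

lemma has_integral_circle_zero:
  fixes H :: "complex \<Rightarrow> complex" and r R :: real
  assumes H: "H holomorphic_on ball 0 R" and r: "0 < r" "r < R"
  shows "((\<lambda>t. H (r * cis (2*pi*t)) * cis (2*pi*t) ^ Suc n) has_integral 0) {0..1}"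
proof -
  have "((\<lambda>u. H u * u ^ n) has_contour_integral 0) (circlepath 0 r)"
    using r by (intro Cauchy_theorem_convex_simple[of _ "ball 0 R"] holomorphic_intros H)
      (auto simp: path_image_circlepath)
  then have "((\<lambda>t. H (r * cis (2*pi*t)) * (r * cis (2*pi*t)) ^ n * (2 * pi * \<i> * r * cis (2*pi*t)))
      has_integral 0) {0..1}"
    unfolding has_contour_integral_def
    by (rule has_integral_eq[rotated])
       (simp add: vector_derivative_circlepath01, simp add: circlepath cis_conv_exp mult_ac)
  from has_integral_mult_right[OF this, of "1 / (2 * pi * \<i> * r ^ Suc n)"]
  have *: "((\<lambda>t. 1 / (2 * pi * \<i> * r ^ Suc n) * (H (r * cis (2*pi*t)) * (r * cis (2*pi*t)) ^ n * (2 * pi * \<i> * r * cis (2*pi*t))))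
      has_integral 0) {0..1}"
    by simp
  show ?thesis
    by (rule has_integral_eq[OF _ *]) (use r in \<open>simp add: power_mult_distrib field_simps\<close>)
qed

text \<open>A holomorphic function has no negative frequencies, so the positive frequencies of the
  sum come from \<open>H\<close> alone and the negative ones from \<open>G\<close> alone.\<close>

lemma has_integral_circle_harmonic:
  fixes H G :: "complex \<Rightarrow> complex" and r :: real
  assumes H: "H holomorphic_on ball 0 1" and G: "G holomorphic_on ball 0 1" and r: "0 < r" "r < 1"
  defines "f \<equiv> \<lambda>t. H (r * cis (2*pi*t)) + cnj (G (r * cis (2*pi*t)))"
  shows "(f has_integral H 0 + cnj (G 0)) {0..1}"
    and "((\<lambda>t. f t * cnj (cis (2*pi*t)) ^ Suc n) has_integral r ^ Suc n * ((deriv ^^ Suc n) H 0 / fact (Suc n))) {0..1}"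
    and "((\<lambda>t. f t * cis (2*pi*t) ^ Suc n) has_integral cnj (r ^ Suc n * ((deriv ^^ Suc n) G 0 / fact (Suc n)))) {0..1}"
proof -
  have cj: "((\<lambda>t. cnj (k t)) has_integral cnj I) {0..1}" if "(k has_integral I) {0..1}" for k :: "real \<Rightarrow> complex" and I
    using has_integral_cnj[of k I "{0..1}"] that by (simp add: o_def)
  note coeff = has_integral_circle_coeff[OF H r] has_integral_circle_coeff[OF G r]
  note zero = has_integral_circle_zero[OF H r] has_integral_circle_zero[OF G r]
  show "(f has_integral H 0 + cnj (G 0)) {0..1}"
    using has_integral_add[OF coeff(1)[of 0] cj[OF coeff(2)[of 0]]] by (simp add: f_def)
  show "((\<lambda>t. f t * cnj (cis (2*pi*t)) ^ Suc n) has_integral r ^ Suc n * ((deriv ^^ Suc n) H 0 / fact (Suc n))) {0..1}"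
    using has_integral_add[OF coeff(1)[of "Suc n"] cj[OF zero(2)[of n]]]
    unfolding f_def by (simp add: distrib_right del: power_Suc funpow.simps fact_Suc)
  show "((\<lambda>t. f t * cis (2*pi*t) ^ Suc n) has_integral cnj (r ^ Suc n * ((deriv ^^ Suc n) G 0 / fact (Suc n)))) {0..1}"
    using has_integral_add[OF zero(1)[of n] cj[OF coeff(2)[of "Suc n"]]]
    unfolding f_def by (simp add: distrib_right del: power_Suc funpow.simps fact_Suc)
qed

lemma deriv_rotate:
  assumes "K holomorphic_on ball 0 1" "norm u = 1"
  shows "(\<lambda>z. K (u * z)) holomorphic_on ball 0 1" "deriv (\<lambda>z. K (u * z)) 0 = u * deriv K 0"
proof -
  have "(K \<circ> (\<lambda>z. u * z)) holomorphic_on ball 0 1"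
    by (rule holomorphic_on_compose_gen[OF _ assms(1)])
       (use assms(2) in \<open>auto intro!: holomorphic_intros simp: norm_mult\<close>)
  then show "(\<lambda>z. K (u * z)) holomorphic_on ball 0 1" by (simp add: o_def)
  have "(K has_field_derivative deriv K 0) (at (u * 0))"
    using holomorphic_derivI[OF assms(1), of 0] by simp
  from DERIV_chain2[where g = "\<lambda>z. u * z" and x = 0 and s = UNIV and Db = u, OF this]
  have "((\<lambda>z. K (u * z)) has_field_derivative deriv K 0 * u) (at 0)"
    by (auto intro!: derivative_eq_intros)
  then show "deriv (\<lambda>z. K (u * z)) 0 = u * deriv K 0"
    by (simp add: DERIV_imp_deriv mult.commute)
qed

text \<open>Replacing \<open>z\<close> by \<open>cnj z\<close> in \<open>H z + cnj (G z)\<close>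
  exchanges the roles of \<open>H\<close> and \<open>G\<close> up to this reflection. It serves the
  orientation reversing case.\<close>

lemma holomorphic_reflect:
  assumes "K holomorphic_on ball 0 1"
  shows "(\<lambda>z. cnj (K (cnj z))) holomorphic_on ball 0 1"
    and "deriv (\<lambda>z. cnj (K (cnj z))) 0 = cnj (deriv K 0)"
proof -
  have "cnj ` ball 0 1 = ball 0 1"
    by (auto simp: image_cnj_conv_vimage_cnj)
  then show "(\<lambda>z. cnj (K (cnj z))) holomorphic_on ball 0 1"
    using holomorphic_on_compose_cnj_cnj[of K "ball 0 1"] assms by (simp add: o_def)
  have "(K has_field_derivative deriv K 0) (at (cnj 0))"
    using holomorphic_derivI[OF assms, of 0] by simp
  from has_field_derivative_cnj_cnj[OF this]
  show "deriv (\<lambda>z. cnj (K (cnj z))) 0 = cnj (deriv K 0)"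
    by (intro DERIV_imp_deriv) (simp add: o_def)
qed

lemma norm_linear_plus_cnj:
  assumes "A = 0 \<or> B = (0::complex)"
  shows "norm (A * v + cnj (B * v)) = (norm A + norm B) * norm v"
  using assms by (auto simp: norm_mult)

text \<open>The order of limits matters: \<open>C\<close> may depend on \<epsilon>, as a constant
  obtained by compactness does, so r tends to 1 with \<epsilon> fixed, and only afterwards does
  \<epsilon> tend to 0.\<close>

lemma eq_from_radial_bound:
  fixes A B :: complex
  assumes "\<And>\<epsilon>. \<epsilon> > 0 \<Longrightarrow> \<exists>C. \<forall>r. 0 < r \<and> r < 1 \<longrightarrow> norm (complex_of_real (r ^ n) * A - B) \<le> \<epsilon> + C * (1 - r)"
  shows "A = B"
proof -
  have "norm (A - B) \<le> 0 + \<epsilon>" if \<epsilon>: "\<epsilon> > 0" for \<epsilon> :: real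
  proof -
    obtain C where C: "\<And>r. 0 < r \<Longrightarrow> r < 1 \<Longrightarrow> norm (complex_of_real (r ^ n) * A - B) \<le> \<epsilon> + C * (1 - r)"
      using assms[OF \<epsilon>] by blast
    have l: "((\<lambda>r. norm (complex_of_real (r ^ n) * A - B)) \<longlongrightarrow> norm (complex_of_real (1 ^ n) * A - B)) (at_left 1)"
      by (intro tendsto_intros)
    have u: "((\<lambda>r. \<epsilon> + C * (1 - r)) \<longlongrightarrow> \<epsilon> + C * (1 - 1)) (at_left (1::real))"
      by (intro tendsto_intros)
    have "eventually (\<lambda>r::real. r \<in> {0<..<1}) (at_left 1)"
      by (rule eventually_at_left_real) simp
    then have "eventually (\<lambda>r. norm (complex_of_real (r ^ n) * A - B) \<le> \<epsilon> + C * (1 - r)) (at_left 1)"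
      by eventually_elim (use C in auto)
    from tendsto_le[OF _ u l this] show ?thesis by simp
  qed
  then have "norm (A - B) \<le> 0" by (rule field_le_epsilon)
  then show ?thesis by simp
qed

section \<open>The image domain\<close>

text \<open>The numbers \<alpha> and \<beta> are reciprocals of zeros of the quadratic, with the
  value 0 standing for a zero at infinity, so lower degrees are included. The bounds with
  \<open>R\<close> keep all zeros out of the open disc of radius \<open>R > 1\<close>, which places
  the unit circle inside the domain of holomorphy.\<close>

locale quadratic_map =
  fixes F :: "complex \<Rightarrow> complex" and \<alpha> \<beta> :: complex and c R :: real
  assumes c_pos: "c > 0" and R_gt_1: "R > 1"
    and \<alpha>_R: "norm \<alpha> * R \<le> 1" and \<beta>_R: "norm \<beta> * R \<le> 1"
    and DERIV_F: "\<And>z. norm z < R \<Longrightarrow> (F has_field_derivative c / ((1 - \<alpha>*z) * (1 - \<beta>*z))) (at z)"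
    and F_0: "F 0 = 0"
begin

definition q :: "complex \<Rightarrow> complex" where "q z = (1 - \<alpha>*z) * (1 - \<beta>*z)"
definition q' :: "complex \<Rightarrow> complex" where "q' z = - \<alpha> * (1 - \<beta>*z) - \<beta> * (1 - \<alpha>*z)"

abbreviation D :: "complex set" where "D \<equiv> F ` ball 0 1"

lemma factors_nonzero:
  assumes "norm z < R"
  shows "1 - \<alpha> * z \<noteq> 0" "1 - \<beta> * z \<noteq> 0"
  using norm_mult_less_1[OF \<alpha>_R assms] norm_mult_less_1[OF \<beta>_R assms] by auto

lemma q_nonzero: "norm z < R \<Longrightarrow> q z \<noteq> 0"
  using factors_nonzero[of z] by (simp add: q_def)

lemma DERIV_q: "(q has_field_derivative q' z) (at z)"
  unfolding q_def q'_def by (auto intro!: derivative_eq_intros)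

lemma DERIV_F_q: "norm z < R \<Longrightarrow> (F has_field_derivative c / q z) (at z)"
  using DERIV_F by (simp add: q_def)

lemma holomorphic_F: "F holomorphic_on ball 0 R"
  using DERIV_F by (fastforce simp: holomorphic_on_open)

lemma continuous_on_F: "continuous_on (ball 0 R) F"
  using holomorphic_F by (rule holomorphic_on_imp_continuous_on)

lemma below_tangent:
  assumes "norm z \<le> norm \<zeta>" "norm \<zeta> < R" "z \<noteq> \<zeta>"
  shows "Re ((F z - F \<zeta>) * (q \<zeta> / \<zeta>)) < 0"
  unfolding q_def using image_below_tangent[OF c_pos \<alpha>_R \<beta>_R DERIV_F] assms by blast

lemma inj_on_F: "inj_on F (ball 0 R)"
proof (rule inj_onI, rule ccontr)
  fix x y assume "x \<in> ball 0 R" "y \<in> ball 0 R" "F x = F y" "x \<noteq> y"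
  then show False
    using below_tangent[of x y] below_tangent[of y x] by (cases "norm x \<le> norm y") auto
qed

lemma ball_1_subset: "ball 0 1 \<subseteq> ball (0::complex) R" "cball 0 1 \<subseteq> ball (0::complex) R"
  using R_gt_1 by auto

lemma open_D: "open D"
  using inj_on_subset[OF inj_on_F ball_1_subset(1)]
    holomorphic_on_subset[OF holomorphic_F ball_1_subset(1)]
  by (intro open_mapping_thm3) auto

lemma compact_F_cball: "compact (F ` cball 0 1)"
  by (intro compact_continuous_image continuous_on_subset[OF continuous_on_F ball_1_subset(2)]) simp

lemma closure_D: "closure D \<subseteq> F ` cball 0 1"
  by (intro closure_minimal compact_imp_closed[OF compact_F_cball] image_mono) auto

lemma bounded_D: "bounded D"
  by (rule bounded_subset[OF compact_imp_bounded[OF compact_F_cball]]) (auto intro: image_mono)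

lemma frontier_D: "frontier D \<subseteq> F ` sphere 0 1"
proof
  fix w assume "w \<in> frontier D"
  then have w: "w \<in> closure D" "w \<notin> D"
    using open_D by (auto simp: frontier_def interior_open)
  then obtain z where "norm z \<le> 1" "w = F z" using closure_D by auto
  with w show "w \<in> F ` sphere 0 1" by force
qed

lemma D_below_tangent:
  assumes "w \<in> D" "norm \<zeta> = 1"
  shows "Re ((w - F \<zeta>) * (q \<zeta> / \<zeta>)) < 0"
proof -
  obtain z where "norm z < 1" "w = F z" using assms by auto
  then show ?thesis using below_tangent[of z \<zeta>] assms R_gt_1 by force
qed

text \<open>A segment from \<open>0\<close> to a point outside \<open>D\<close> crosses the boundary, and beyond the crossing
  point it lies above the tangent line there.\<close>

lemma D_eq_Inter_halfplanes:
  "D = (\<Inter>\<zeta>\<in>sphere 0 1. {w. Re ((w - F \<zeta>) * (q \<zeta> / \<zeta>)) < 0})" (is "_ = ?K")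
proof
  show "D \<subseteq> ?K" using D_below_tangent by auto
  show "?K \<subseteq> D"
  proof (rule ccontr)
    assume "\<not> ?K \<subseteq> D"
    then obtain w where w: "w \<in> ?K" "w \<notin> D" by blast
    have "0 \<in> D" using F_0 by (force intro: image_eqI[of _ _ 0])
    then have "closed_segment 0 w \<inter> frontier D \<noteq> {}"
      using w by (intro connected_Int_frontier) auto
    then obtain \<zeta> s where \<zeta>: "norm \<zeta> = 1" "F \<zeta> = s *\<^sub>R w" and s: "0 \<le> s" "s \<le> 1"
      using frontier_D by (fastforce simp: in_segment)
    define k where "k = q \<zeta> / \<zeta>"
    have "Re ((0 - F \<zeta>) * k) < 0"
      unfolding k_def using D_below_tangent[OF \<open>0 \<in> D\<close> \<zeta>(1)] .
    then have "s * Re (w * k) > 0" by (simp add: \<zeta> algebra_simps)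
    then have "Re (w * k) > 0" using s by (auto simp: zero_less_mult_iff)
    moreover have "Re ((w - F \<zeta>) * k) < 0" unfolding k_def using INT_D[OF w(1), of \<zeta>] \<zeta>(1) by (simp only: mem_Collect_eq mem_sphere_0)
    then have "(1 - s) * Re (w * k) < 0" by (simp add: \<zeta> algebra_simps)
    ultimately show False using s by (simp add: mult_less_0_iff)
  qed
qed

lemma convex_D: "convex D"
proof -
  have "convex {w. Re ((w - x) * k) < 0}" for x k :: complex
  proof -
    have "{w. Re ((w - x) * k) < 0} = {w. inner (cnj k) w < Re (x * k)}"
      by (auto simp: inner_complex_def algebra_simps)
    then show ?thesis by (simp add: convex_halfspace_lt)
  qed
  then show ?thesis
    by (subst D_eq_Inter_halfplanes) (blast intro: convex_INT)
qed

text \<open>The left side is the rate at which the tangent direction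
  \<open>\<i> * \<zeta> / q \<zeta>\<close> turns as \<zeta> runs through the circle, that is, speed
  times curvature of the boundary. It splits into the same two halved Cayley transforms as the
  derivative of the tangent angle.\<close>

lemma curvature_pos:
  assumes "norm \<zeta> = 1"
  shows "Re (1 - \<zeta> * q' \<zeta> / q \<zeta>) > 0"
proof -
  have z: "norm \<zeta> < R" using assms R_gt_1 by simp
  have "1 - \<zeta> * q' \<zeta> / q \<zeta> = (1/2 + \<alpha> * \<zeta> / (1 - \<alpha> * \<zeta>)) + (1/2 + \<beta> * \<zeta> / (1 - \<beta> * \<zeta>))"
    using factors_nonzero[OF z] by (simp add: q_def q'_def divide_simps) (simp add: algebra_simps)
  then show ?thesis
    using Re_half_moebius_pos[OF norm_mult_less_1[OF \<alpha>_R z]]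
      Re_half_moebius_pos[OF norm_mult_less_1[OF \<beta>_R z]]
    by (metis plus_complex.simps(1) add_pos_pos)
qed

text \<open>The inverse is taken on the image of the larger disc, because a defining function of
  \<open>D\<close> has to live on a neighbourhood of its closure.\<close>

lemma inverse_exists:
  obtains G where "\<And>z. norm z < R \<Longrightarrow> G (F z) = z"
    "\<And>w. w \<in> F ` ball 0 R \<Longrightarrow> (G has_field_derivative q (G w) / c) (at w)"
proof -
  obtain G where G: "G holomorphic_on F ` ball 0 R"
    "\<And>z. z \<in> ball 0 R \<Longrightarrow> deriv F z * deriv G (F z) = 1"
    "\<And>z. z \<in> ball 0 R \<Longrightarrow> G (F z) = z"
    using holomorphic_has_inverse[OF holomorphic_F _ inj_on_F] by auto
  have "open (F ` ball 0 R)"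
    by (intro open_mapping_thm3 holomorphic_F inj_on_F) auto
  then have *: "(G has_field_derivative deriv G w) (at w)" if "w \<in> F ` ball 0 R" for w
    using G(1) that by (intro holomorphic_derivI)
  have "(G has_field_derivative q (G w) / c) (at w)" if w: "w \<in> F ` ball 0 R" for w
  proof -
    obtain z where z: "z \<in> ball 0 R" "w = F z" using w by blast
    then have "c / q z * deriv G w = 1"
      using G(2)[of z] DERIV_imp_deriv[OF DERIV_F_q[of z]] by simp
    then have "deriv G w = q z / c"
      using q_nonzero[of z] z c_pos by (simp add: field_simps)
    then show ?thesis using *[OF w] z G(3) by simp
  qed
  then show ?thesis using that[of G] G(3) by simp
qed

text \<open>The defining function is \<open>\<bar>F\<inverse>\<bar>\<^sup>2 - 1\<close>. Since \<open>G = F\<inverse>\<close> satisfies \<open>G' = q \<circ> G / c\<close>,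
  both of its derivatives are polynomial expressions in \<open>G\<close>.\<close>

lemma strongly_convex_D: "strongly_convex_domain D"
proof -
  obtain G where GF: "\<And>z. norm z < R \<Longrightarrow> G (F z) = z"
    and dG: "\<And>w. w \<in> F ` ball 0 R \<Longrightarrow> (G has_field_derivative q (G w) / c) (at w)"
    by (rule inverse_exists) blast
  define U where "U = F ` ball 0 R"
  define \<rho> where "\<rho> w = Re (G w * cnj (G w)) - 1" for w
  \<comment> \<open>\<open>p\<close> and \<open>p'\<close> are the first and second complex
    derivatives of \<open>G\<close>.\<close>
  define p where "p w = q (G w) / c" for w
  define p' where "p' w = q' (G w) * p w / c" for w
  define D\<rho> where "D\<rho> w u = 2 * Re (cnj (G w) * p w * u)" for w u
  define D2\<rho> where "D2\<rho> w u v = 2 * Re ((cnj (p w * v) * p w + cnj (G w) * (p' w * v)) * u)" for w u v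
  have openU: "open U"
    unfolding U_def by (intro open_mapping_thm3 holomorphic_F inj_on_F) auto
  have G': "(G has_derivative (\<lambda>v. p w * v)) (at w)" if "w \<in> U" for w
    using dG[of w] that unfolding U_def p_def has_field_derivative_def .
  have P': "(p has_derivative (\<lambda>v. p' w * v)) (at w)" if "w \<in> U" for w
  proof -
    have "((\<lambda>w. q (G w)) has_field_derivative q' (G w) * p w) (at w)"
      unfolding p_def using that by (intro DERIV_chain2[OF DERIV_q dG]) (simp add: U_def)
    from DERIV_cdivide[OF this, of c] show ?thesis
      unfolding p_def[abs_def, symmetric] p'_def has_field_derivative_def .
  qed
  have contG: "continuous_on U G" and contp: "continuous_on U p"
    using G' P' by (meson continuous_at_imp_continuous_on has_derivative_continuous)+
  have contp': "continuous_on U p'"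
    unfolding p'_def q'_def by (intro continuous_intros contG contp) (use c_pos in auto)
  have 1: "(\<rho> has_derivative D\<rho> w) (at w)" if "w \<in> U" for w
    using has_derivative_diff[OF has_derivative_Re[OF has_derivative_mult[OF
          G'[OF that] has_derivative_cnj[OF G'[OF that]]]] has_derivative_const[of 1]]
    unfolding \<rho>_def D\<rho>_def
    by (rule has_derivative_eq_rhs) (simp add: fun_eq_iff algebra_simps)
  have 2: "((\<lambda>w. D\<rho> w u) has_derivative D2\<rho> w u) (at w)" if "w \<in> U" for w u
    using has_derivative_mult_right[OF has_derivative_Re[OF has_derivative_mult_left[OF
          has_derivative_mult[OF has_derivative_cnj[OF G'[OF that]] P'[OF that]], of u]], of 2]
    unfolding D\<rho>_def D2\<rho>_def
    by (rule has_derivative_eq_rhs) (simp add: fun_eq_iff algebra_simps)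
  have 3: "continuous_on U (\<lambda>w. D2\<rho> w u v)" for u v
    unfolding D2\<rho>_def by (intro continuous_intros contG contp contp')
  have \<rho>F: "\<rho> (F z) = (norm z)\<^sup>2 - 1" if "norm z < R" for z
    using GF[OF that] by (simp add: \<rho>_def complex_mult_cnj cmod_power2)
  have 4: "D = {z \<in> U. \<rho> z < 0}"
    using \<rho>F R_gt_1 by (auto simp: U_def abs_square_less_1)
  have 5: "\<rho> w = 0 \<and> D\<rho> w \<noteq> (\<lambda>_. 0) \<and> (\<forall>v. v \<noteq> 0 \<and> D\<rho> w v = 0 \<longrightarrow> D2\<rho> w v v > 0)"
    if w: "w \<in> frontier D" for w
  proof -
    obtain \<zeta> where \<zeta>: "norm \<zeta> = 1" "w = F \<zeta>" using frontier_D w by auto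
    then have z: "norm \<zeta> < R" using R_gt_1 by simp
    have Gw: "G w = \<zeta>" using GF[OF z] \<zeta> by simp
    have p0: "p w \<noteq> 0" using q_nonzero[OF z] c_pos by (simp add: p_def Gw)
    have cz: "\<zeta> * cnj \<zeta> = 1" using \<zeta> by (simp add: complex_norm_square[symmetric])
    have "D\<rho> w (\<zeta> / p w) = 2"
      using p0 cz by (simp add: D\<rho>_def Gw mult.commute)
    then have "D\<rho> w \<noteq> (\<lambda>_. 0)" by auto
    moreover have "D2\<rho> w v v > 0" if v: "v \<noteq> 0" "D\<rho> w v = 0" for v
    proof -
      \<comment> \<open>A vector tangent to the boundary is sent by the derivative of
        \<open>G\<close> to a vector tangent to the unit circle at \<zeta>, hence to a real multiple
        \<open>t\<close> of \<open>\<zeta> * \<i>\<close>.\<close>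
      define t where "t = Im (cnj \<zeta> * (p w * v))"
      have s: "cnj \<zeta> * (p w * v) = \<i> * t"
        using v by (simp add: complex_eq_iff t_def D\<rho>_def Gw mult.assoc)
      have y: "p w * v = \<zeta> * \<i> * t"
      proof -
        have "p w * v = (\<zeta> * cnj \<zeta>) * (p w * v)" by (simp add: cz)
        also have "\<dots> = \<zeta> * (cnj \<zeta> * (p w * v))" by (simp only: mult.assoc)
        finally show ?thesis by (simp add: s)
      qed
      have t0: "t \<noteq> 0" using y p0 v by auto
      have q0: "q \<zeta> \<noteq> 0" using q_nonzero[OF z] .
      have vq: "v / c = \<zeta> * \<i> * t / q \<zeta>"
      proof -
        have "q \<zeta> * v = \<zeta> * \<i> * t * c" using y c_pos by (simp add: p_def Gw field_simps)
        then show ?thesis using q0 c_pos by (simp add: field_simps)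
      qed
      \<comment> \<open>The two terms of the Hessian, \<open>a\<close> from the product of first
        derivatives and \<open>b\<close> from the second derivative of \<open>G\<close>, combine to
        \<open>t\<^sup>2\<close> times the expression of \<open>curvature_pos\<close>.\<close>
      have "cnj (p w * v) * p w * v = cnj (\<zeta> * \<i> * t) * (\<zeta> * \<i> * t)"
        using y by (simp add: mult.assoc)
      also have "\<dots> = (\<zeta> * cnj \<zeta>) * t\<^sup>2" by (simp add: algebra_simps power2_eq_square)
      finally have a: "cnj (p w * v) * p w * v = t\<^sup>2" by (simp add: cz)
      have "cnj (G w) * (p' w * v) * v = cnj \<zeta> * q' \<zeta> * (p w * v) * (v / c)"
        by (simp add: Gw p'_def)
      also have "\<dots> = cnj \<zeta> * q' \<zeta> * (\<zeta> * \<i> * t) * (\<zeta> * \<i> * t / q \<zeta>)"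
        by (simp only: vq y)
      also have "\<dots> = - ((\<zeta> * cnj \<zeta>) * (\<zeta> * q' \<zeta> / q \<zeta>) * t\<^sup>2)"
        using q0 by (simp add: field_simps power2_eq_square)
      finally have b: "cnj (G w) * (p' w * v) * v = - (\<zeta> * q' \<zeta> / q \<zeta> * t\<^sup>2)" by (simp add: cz)
      have "D2\<rho> w v v = 2 * Re (cnj (p w * v) * p w * v + cnj (G w) * (p' w * v) * v)"
        by (simp only: D2\<rho>_def distrib_right)
      also have "\<dots> = 2 * Re ((1 - \<zeta> * q' \<zeta> / q \<zeta>) * of_real (t\<^sup>2))"
        unfolding a b by (simp add: algebra_simps)
      also have "\<dots> = 2 * (Re (1 - \<zeta> * q' \<zeta> / q \<zeta>) * t\<^sup>2)"
        by (simp only: Re_complex_of_real times_complex.sel Im_complex_of_real) simp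
      finally show ?thesis using curvature_pos[OF \<zeta>(1)] t0 by simp
    qed
    ultimately show ?thesis using \<rho>F[OF z] \<zeta> by auto
  qed
  have "closure D \<subseteq> U" using closure_D ball_1_subset(2) unfolding U_def by blast
  moreover have "connected D" "D \<noteq> {}" using convex_D by (auto intro: convex_connected)
  ultimately show ?thesis
    unfolding strongly_convex_domain_def
    by (intro conjI exI[of _ U] exI[of _ \<rho>] exI[of _ D\<rho>] exI[of _ D2\<rho>])
       (simp_all only: open_D bounded_D convex_D openU 1 2 3 5 4[symmetric], simp_all, (use 1 2 5 in blast)+)
qed

section \<open>Extremal maps\<close>

lemma q_over_unit:
  assumes "norm \<zeta> = 1"
  shows "q \<zeta> / \<zeta> = cnj \<zeta> - (\<alpha> + \<beta>) + \<alpha> * \<beta> * \<zeta>"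
proof -
  have "\<zeta> * cnj \<zeta> = 1" using assms by (simp add: complex_norm_square[symmetric])
  moreover have "\<zeta> \<noteq> 0" using assms by auto
  ultimately show ?thesis by (simp add: q_def field_simps)
qed

lemma deriv_F_0: "deriv F 0 = c"
  using DERIV_imp_deriv[OF DERIV_F_q[of 0]] R_gt_1 by (simp add: q_def)

text \<open>The competitor is sampled at radius \<open>r\<close> and \<open>F\<close> on the unit
  circle itself. Against the weight, \<open>F\<close> contributes only through its frequency 1, with
  coefficient c: its mean is \<open>F 0 = 0\<close>, and it has no frequency -1.\<close>

lemma has_integral_tangent_height:
  fixes H G :: "complex \<Rightarrow> complex" and r :: real
  assumes H: "H holomorphic_on ball 0 1" and G: "G holomorphic_on ball 0 1"
    and 0: "H 0 = 0" "G 0 = 0" and r: "0 < r" "r < 1"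
  defines "f \<equiv> \<lambda>t. H (r * cis (2*pi*t)) + cnj (G (r * cis (2*pi*t)))"
  shows "((\<lambda>t. Re ((f t - F (cis (2*pi*t))) * (q (cis (2*pi*t)) / cis (2*pi*t)))) has_integral
      Re (r * deriv H 0 + \<alpha> * \<beta> * cnj (r * deriv G 0)) - c) {0..1}"
proof -
  note h = has_integral_circle_harmonic[OF H G r, folded f_def]
  have f0: "(f has_integral 0) {0..1}" using h(1) 0 by simp
  have f1: "((\<lambda>t. f t * cnj (cis (2*pi*t))) has_integral r * deriv H 0) {0..1}"
    using h(2)[of 0] by (simp add: f_def)
  have f2: "((\<lambda>t. f t * cis (2*pi*t)) has_integral cnj (r * deriv G 0)) {0..1}"
    using h(3)[of 0] by (simp add: f_def)
  note k = has_integral_circle_coeff[OF holomorphic_F zero_less_one R_gt_1]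
  have F0: "((\<lambda>t. F (cis (2*pi*t))) has_integral 0) {0..1}"
    using k[of 0] F_0 by simp
  have F1: "((\<lambda>t. F (cis (2*pi*t)) * cnj (cis (2*pi*t))) has_integral c) {0..1}"
    using k[of 1] deriv_F_0 by simp
  have F2: "((\<lambda>t. F (cis (2*pi*t)) * cis (2*pi*t)) has_integral 0) {0..1}"
    using has_integral_circle_zero[OF holomorphic_F zero_less_one R_gt_1, of 0] by simp
  have "((\<lambda>t. (f t * cnj (cis (2*pi*t)) - F (cis (2*pi*t)) * cnj (cis (2*pi*t)))
        + - (\<alpha> + \<beta>) * (f t - F (cis (2*pi*t)))
        + \<alpha> * \<beta> * (f t * cis (2*pi*t) - F (cis (2*pi*t)) * cis (2*pi*t)))
      has_integral ((r * deriv H 0 - c) + - (\<alpha> + \<beta>) * (0 - 0)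
        + \<alpha> * \<beta> * (cnj (r * deriv G 0) - 0))) {0..1}"
    by (intro has_integral_add has_integral_diff has_integral_mult_right f0 f1 f2 F0 F1 F2)
  from has_integral_linear[OF this bounded_linear_Re]
  have *: "((\<lambda>t. Re ((f t * cnj (cis (2*pi*t)) - F (cis (2*pi*t)) * cnj (cis (2*pi*t)))
        + - (\<alpha> + \<beta>) * (f t - F (cis (2*pi*t)))
        + \<alpha> * \<beta> * (f t * cis (2*pi*t) - F (cis (2*pi*t)) * cis (2*pi*t))))
      has_integral (Re (r * deriv H 0 + \<alpha> * \<beta> * cnj (r * deriv G 0)) - c)) {0..1}"
    by (simp add: o_def algebra_simps)
  show ?thesis
  proof (rule has_integral_eq[OF _ *])
    fix t :: real
    show "Re ((f t * cnj (cis (2*pi*t)) - F (cis (2*pi*t)) * cnj (cis (2*pi*t)))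
        + - (\<alpha> + \<beta>) * (f t - F (cis (2*pi*t)))
        + \<alpha> * \<beta> * (f t * cis (2*pi*t) - F (cis (2*pi*t)) * cis (2*pi*t)))
      = Re ((f t - F (cis (2*pi*t))) * (q (cis (2*pi*t)) / cis (2*pi*t)))"
      unfolding q_over_unit[OF norm_cis] by (intro arg_cong[of _ _ Re]) algebra
  qed
qed

text \<open>A quantitative form of strict convexity, obtained by compactness.\<close>

lemma distance_le_tangent_height:
  assumes \<epsilon>: "\<epsilon> > 0"
  shows "\<exists>C. \<forall>w\<in>D. \<forall>\<zeta>. norm \<zeta> = 1 \<longrightarrow> norm (w - F \<zeta>) \<le> \<epsilon> - C * Re ((w - F \<zeta>) * (q \<zeta> / \<zeta>))"
proof -
  define N where "N p = norm (F (fst p) - F (snd p))" for p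
  define P where "P p = Re ((F (fst p) - F (snd p)) * (q (snd p) / snd p))" for p
  define X where "X = cball (0::complex) 1 \<times> sphere (0::complex) 1"
  \<comment> \<open>On the compact set \<open>K\<close> the height \<open>P\<close> is strictly
    negative, so \<open>N / P\<close> is bounded. Near coinciding points both vanish and no bound on
    the ratio is at hand; there \<epsilon> alone covers the distance.\<close>
  define K where "K = {p \<in> X. \<epsilon> \<le> N p}"
  have cF: "continuous_on X (\<lambda>p. F (fst p))" "continuous_on X (\<lambda>p. F (snd p))"
    using R_gt_1 by (auto simp: X_def intro!: continuous_on_compose2[OF continuous_on_F] continuous_intros)
  have cN: "continuous_on X N" unfolding N_def by (intro continuous_intros cF)
  have cP: "continuous_on X P" unfolding P_def q_def
    by (intro continuous_intros cF) (auto simp: X_def)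
  have cX: "compact X" unfolding X_def by (intro compact_Times) auto
  have "K = X \<inter> N -` {\<epsilon>..}" by (auto simp: K_def)
  then have "closed K"
    using continuous_closed_preimage[OF cN compact_imp_closed[OF cX] closed_atLeast[of \<epsilon>]] by simp
  moreover have "K = X \<inter> K" by (auto simp: K_def)
  ultimately have cK: "compact K" using compact_Int_closed[OF cX] by metis
  have neg: "P p < 0" if "p \<in> K" for p
  proof -
    have "fst p \<noteq> snd p" using that \<epsilon> by (auto simp: K_def N_def)
    then show ?thesis unfolding P_def
      using that R_gt_1 by (intro below_tangent) (auto simp: K_def X_def)
  qed
  have "continuous_on K (\<lambda>p. N p / P p)"
    by (intro continuous_intros continuous_on_subset[OF cN] continuous_on_subset[OF cP])
      (use neg less_irrefl in \<open>force simp: K_def\<close>)+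
  then have "bounded ((\<lambda>p. N p / P p) ` K)"
    by (intro compact_imp_bounded compact_continuous_image cK)
  then obtain C where C: "C > 0" "\<And>p. p \<in> K \<Longrightarrow> \<bar>N p / P p\<bar> \<le> C"
    by (auto simp: bounded_pos)
  have "norm (w - F \<zeta>) \<le> \<epsilon> - C * Re ((w - F \<zeta>) * (q \<zeta> / \<zeta>))" if w: "w \<in> D" "norm \<zeta> = 1" for w \<zeta>
  proof -
    obtain z where z: "norm z < 1" "w = F z" using w by auto
    then have X: "(z, \<zeta>) \<in> X" using w by (simp add: X_def)
    have le: "P (z, \<zeta>) < 0" using D_below_tangent[OF w] z by (simp add: P_def)
    have "N (z, \<zeta>) \<le> \<epsilon> - C * P (z, \<zeta>)"
    proof (cases "(z, \<zeta>) \<in> K")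
      case True
      have "N (z, \<zeta>) = \<bar>N (z, \<zeta>) / P (z, \<zeta>)\<bar> * - P (z, \<zeta>)"
        using le by (simp add: N_def)
      also have "\<dots> \<le> C * - P (z, \<zeta>)" using le C(2)[OF True] by (intro mult_right_mono) auto
      finally show ?thesis using \<epsilon> by simp
    next
      case False
      then have "N (z, \<zeta>) < \<epsilon>" using X by (simp add: K_def)
      moreover have "C * P (z, \<zeta>) \<le> 0" using le C(1) by (simp add: mult_le_0_iff)
      ultimately show ?thesis by linarith
    qed
    then show ?thesis by (simp add: N_def P_def z)
  qed
  then show ?thesis by blast
qed

context
  fixes H G :: "complex \<Rightarrow> complex"
  assumes H: "H holomorphic_on ball 0 1" and G: "G holomorphic_on ball 0 1"
    and H0: "H 0 = 0" and G0: "G 0 = 0"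
    and into: "\<And>z. z \<in> ball 0 1 \<Longrightarrow> H z + cnj (G z) \<in> D"
    and G': "deriv G 0 = 0"
begin

lemma circle_into: "0 < r \<Longrightarrow> r < 1 \<Longrightarrow> H (complex_of_real r * cis t) + cnj (G (r * cis t)) \<in> D"
  by (rule into) (simp add: norm_mult)

text \<open>With \<open>deriv G 0 = 0\<close> the mean tangent height is
  \<open>r * Re (deriv H 0) - c\<close>, and it is the mean of a negative function for every r <
  1.\<close>

lemma Re_deriv_le: "Re (deriv H 0) \<le> c"
proof (rule field_le_mult_one_interval)
  fix r :: real assume r: "0 < r" "r < 1"
  have "Re (r * deriv H 0 + \<alpha> * \<beta> * cnj (r * deriv G 0)) - c \<le> 0"
    by (rule has_integral_le[OF has_integral_tangent_height[OF H G H0 G0 r] has_integral_0])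
       (intro less_imp_le D_below_tangent circle_into r norm_cis)
  then show "r * Re (deriv H 0) \<le> c" using G' by simp
qed

text \<open>In the extremal case the mean tangent height at radius \<open>r\<close> is \<open>- c (1 - r)\<close>, which
  forces the Fourier coefficients of \<open>H + cnj G\<close> on the circle of radius \<open>r\<close> towards those of \<open>F\<close>.\<close>

lemma extremal_unique:
  assumes ext: "deriv H 0 = c" and z: "z \<in> ball 0 1"
  shows "H z = F z" "G z = 0"
proof -
  define f where "f r t = H (complex_of_real r * cis (2*pi*t)) + cnj (G (r * cis (2*pi*t)))" for r t :: real
  \<comment> \<open>Multiplication by a unimodular \<open>k\<close> leaves the integrable majorant
    unchanged, so a single \<open>C\<close>, depending only on \<epsilon>, serves all Fourier
    characters and all radii.\<close>
  have bound: "\<exists>C. \<forall>r I k. 0 < r \<and> r < 1 \<and> (\<forall>t. norm (k t) = 1) \<and>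
      ((\<lambda>t. (f r t - F (cis (2*pi*t))) * k t) has_integral I) {0..1} \<longrightarrow> norm I \<le> \<epsilon> + C * (1 - r)"
    if \<epsilon>: "\<epsilon> > 0" for \<epsilon> :: real
  proof -
    obtain C where C: "\<And>w \<zeta>. w \<in> D \<Longrightarrow> norm \<zeta> = 1 \<Longrightarrow>
        norm (w - F \<zeta>) \<le> \<epsilon> - C * Re ((w - F \<zeta>) * (q \<zeta> / \<zeta>))"
      using distance_le_tangent_height[OF \<epsilon>] by blast
    have "norm I \<le> \<epsilon> + (C * c) * (1 - r)"
      if r: "0 < r" "r < 1" and k: "\<And>t. norm (k t) = 1"
        and I: "((\<lambda>t. (f r t - F (cis (2*pi*t))) * k t) has_integral I) {0..1}" for r I k
    proof -
      let ?h = "\<lambda>t. Re ((f r t - F (cis (2*pi*t))) * (q (cis (2*pi*t)) / cis (2*pi*t)))"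
      have "(?h has_integral (r * c - c)) {0..1}"
        using has_integral_tangent_height[OF H G H0 G0 r] ext G' by (simp add: f_def)
      then have g: "((\<lambda>t. \<epsilon> - C * ?h t) has_integral (\<epsilon> - C * (r * c - c))) {0..1}"
        using has_integral_const_real[of \<epsilon> 0 1] by (intro has_integral_diff has_integral_mult_right) simp
      have "norm (integral {0..1} (\<lambda>t. (f r t - F (cis (2*pi*t))) * k t))
          \<le> integral {0..1} (\<lambda>t. \<epsilon> - C * ?h t)"
      proof (rule Henstock_Kurzweil_Integration.integral_norm_bound_integral)
        fix t :: real
        have "f r t \<in> D" unfolding f_def by (rule circle_into[OF r])
        from C[OF this norm_cis]
        show "norm ((f r t - F (cis (2*pi*t))) * k t) \<le> \<epsilon> - C * ?h t"
          by (simp only: norm_mult k mult_1_right)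
      qed (use I g in auto)
      then show ?thesis
        using integral_unique[OF I] integral_unique[OF g] by (simp add: algebra_simps)
    qed
    then show ?thesis by blast
  qed
  have hH: "(deriv ^^ n) H 0 = (deriv ^^ n) F 0" for n
  proof (cases n)
    case 0
    then show ?thesis using H0 F_0 by simp
  next
    case (Suc m)
    have "(deriv ^^ Suc m) H 0 / fact (Suc m) = (deriv ^^ Suc m) F 0 / fact (Suc m)"
    proof (rule eq_from_radial_bound[of "Suc m"])
      fix \<epsilon> :: real assume "\<epsilon> > 0"
      from bound[OF this] obtain C where C: "\<And>r I k. \<lbrakk>0 < r; r < 1; \<And>t. norm (k t) = 1;
        ((\<lambda>t. (f r t - F (cis (2*pi*t))) * k t) has_integral I) {0..1}\<rbrakk> \<Longrightarrow> norm I \<le> \<epsilon> + C * (1 - r)"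
        by blast
      have "norm (complex_of_real (r ^ Suc m) * ((deriv ^^ Suc m) H 0 / fact (Suc m)) - (deriv ^^ Suc m) F 0 / fact (Suc m))
          \<le> \<epsilon> + C * (1 - r)" if r: "0 < r" "r < 1" for r
      proof (rule C[OF r, where k = "\<lambda>t. cnj (cis (2*pi*t)) ^ Suc m"])
        show "((\<lambda>t. (f r t - F (cis (2*pi*t))) * cnj (cis (2*pi*t)) ^ Suc m) has_integral
          complex_of_real (r ^ Suc m) * ((deriv ^^ Suc m) H 0 / fact (Suc m)) - (deriv ^^ Suc m) F 0 / fact (Suc m)) {0..1}"
          using has_integral_diff[OF has_integral_circle_harmonic(2)[OF H G r, of m]
              has_integral_circle_coeff[OF holomorphic_F zero_less_one R_gt_1, of "Suc m"]]
          unfolding f_def left_diff_distrib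
          by (simp del: power_Suc funpow.simps fact_Suc)
      qed (simp add: norm_power norm_mult)
      then show "\<exists>C. \<forall>r. 0 < r \<and> r < 1 \<longrightarrow> norm (complex_of_real (r ^ Suc m) * ((deriv ^^ Suc m) H 0 / fact (Suc m))
          - (deriv ^^ Suc m) F 0 / fact (Suc m)) \<le> \<epsilon> + C * (1 - r)"
        by blast
    qed
    then show ?thesis using Suc by (simp del: power_Suc funpow.simps fact_Suc)
  qed
  have hG: "(deriv ^^ n) G 0 = 0" for n
  proof (cases n)
    case 0
    then show ?thesis using G0 by simp
  next
    case (Suc m)
    \<comment> \<open>The negative frequencies of \<open>F\<close> on the unit circle vanish, so the
      target value is 0.\<close>
    have "(deriv ^^ Suc m) G 0 / fact (Suc m) = 0"
    proof (rule eq_from_radial_bound[of "Suc m"])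
      fix \<epsilon> :: real assume "\<epsilon> > 0"
      from bound[OF this] obtain C where C: "\<And>r I k. \<lbrakk>0 < r; r < 1; \<And>t. norm (k t) = 1;
        ((\<lambda>t. (f r t - F (cis (2*pi*t))) * k t) has_integral I) {0..1}\<rbrakk> \<Longrightarrow> norm I \<le> \<epsilon> + C * (1 - r)"
        by blast
      have "norm (complex_of_real (r ^ Suc m) * ((deriv ^^ Suc m) G 0 / fact (Suc m)) - 0) \<le> \<epsilon> + C * (1 - r)"
        if r: "0 < r" "r < 1" for r
      proof -
        have "((\<lambda>t. (f r t - F (cis (2*pi*t))) * cis (2*pi*t) ^ Suc m) has_integral
          cnj (complex_of_real (r ^ Suc m) * ((deriv ^^ Suc m) G 0 / fact (Suc m)))) {0..1}"
          using has_integral_diff[OF has_integral_circle_harmonic(3)[OF H G r, of m]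
              has_integral_circle_zero[OF holomorphic_F zero_less_one R_gt_1, of m]]
          unfolding f_def left_diff_distrib
          by (simp del: power_Suc funpow.simps fact_Suc)
        from C[OF r _ this] show ?thesis
          by (simp only: complex_mod_cnj diff_0_right norm_power norm_cis power_one)
      qed
      then show "\<exists>C. \<forall>r. 0 < r \<and> r < 1 \<longrightarrow> norm (complex_of_real (r ^ Suc m) * ((deriv ^^ Suc m) G 0 / fact (Suc m)) - 0)
          \<le> \<epsilon> + C * (1 - r)"
        by blast
    qed
    then show ?thesis using Suc by (simp del: power_Suc funpow.simps fact_Suc)
  qed
  show "H z = F z"
    by (rule holomorphic_fun_eq_on_ball[OF H holomorphic_on_subset[OF holomorphic_F ball_1_subset(1)] z hH])
  show "G z = 0"
    by (rule holomorphic_fun_eq_0_on_ball[OF G z hG])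
qed

end

text \<open>Rotating the variable makes \<open>deriv H 0\<close> a nonnegative real without changing
  the image, which turns the bound on the real part into one on the modulus. Undoing the rotation
  produces the factor \<open>exp (\<i> * \<theta>)\<close>.\<close>

lemma sense_preserving_extremal:
  assumes H: "H holomorphic_on ball 0 1" and G: "G holomorphic_on ball 0 1"
    and 0: "H 0 = 0" "G 0 = 0"
    and into: "\<And>z. z \<in> ball 0 1 \<Longrightarrow> H z + cnj (G z) \<in> D"
    and G': "deriv G 0 = 0"
  shows "norm (deriv H 0) \<le> c"
    and "norm (deriv H 0) = c \<Longrightarrow> \<exists>\<theta>::real. \<forall>z\<in>ball 0 1. H z + cnj (G z) = F (exp (\<i> * \<theta>) * z)"
proof -
  \<comment> \<open>If \<open>deriv H 0 = 0\<close>, the default value of \<open>Arg\<close> is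
    harmless: the polar form still holds with modulus 0.\<close>
  define \<theta> where "\<theta> = Arg (deriv H 0)"
  define u where "u = cis (- \<theta>)"
  have u: "norm u = 1" by (simp add: u_def)
  have "deriv H 0 = norm (deriv H 0) * cis \<theta>"
    by (metis \<theta>_def rcis_cmod_Arg rcis_def)
  then have "u * deriv H 0 = norm (deriv H 0) * (cis (- \<theta>) * cis \<theta>)"
    by (simp add: u_def mult_ac)
  then have uH: "u * deriv H 0 = norm (deriv H 0)" by (simp add: cis_mult)
  note Hu = deriv_rotate[OF H u] and Gu = deriv_rotate[OF G u]
  have into': "H (u * z) + cnj (G (u * z)) \<in> D" if "z \<in> ball 0 1" for z
    using that u by (intro into) (simp add: norm_mult)
  have zero': "H (u * 0) = 0" "G (u * 0) = 0" "deriv (\<lambda>z. G (u * z)) 0 = 0"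
    using 0 Gu G' by auto
  show "norm (deriv H 0) \<le> c"
    using Re_deriv_le[OF Hu(1) Gu(1) zero'(1,2) into' zero'(3)] by (simp add: Hu(2) uH)
  assume c: "norm (deriv H 0) = c"
  have "H z + cnj (G z) = F (exp (\<i> * \<theta>) * z)" if z: "z \<in> ball 0 1" for z
  proof -
    have *: "u * (cis \<theta> * z) = z" by (simp add: u_def cis_mult flip: mult.assoc)
    have z': "cis \<theta> * z \<in> ball 0 1" using z by (simp add: norm_mult)
    have e: "deriv (\<lambda>z. H (u * z)) 0 = c" by (simp add: Hu(2) uH c)
    have "H z = F (cis \<theta> * z)" "G z = 0"
      using extremal_unique[OF Hu(1) Gu(1) zero'(1,2) into' zero'(3) e z'] by (simp_all only: *)
    then show ?thesis by (simp add: cis_conv_exp)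
  qed
  then show "\<exists>\<theta>::real. \<forall>z\<in>ball 0 1. H z + cnj (G z) = F (exp (\<i> * \<theta>) * z)" by blast
qed

text \<open>The differential at 0 is \<open>A * v + cnj (B * v)\<close>. Conformality makes one
  summand vanish, so the operator norm is the modulus of the other coefficient, and the two cases
  give the two families of extremals.\<close>

lemma admissible_extremal:
  assumes f: "admissible D 0 f"
  shows "onorm (frechet_derivative f (at 0)) \<le> c"
    and "onorm (frechet_derivative f (at 0)) = c \<Longrightarrow>
      (\<exists>\<theta>::real. \<forall>z\<in>ball 0 1. f z = F (exp (\<i> * \<theta>) * z)) \<or>
      (\<exists>\<theta>::real. \<forall>z\<in>ball 0 1. f z = F (exp (\<i> * \<theta>) * cnj z))"
proof -
  let ?L = "frechet_derivative f (at 0)"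
  have harm: "harmonic_on f (ball 0 1)" and f0: "f 0 = 0" and conf: "conformal_linear ?L"
    and fD: "\<And>z. z \<in> ball 0 1 \<Longrightarrow> f z \<in> D"
    using f unfolding admissible_def by auto
  obtain H G where H: "H holomorphic_on ball 0 1" and G: "G holomorphic_on ball 0 1"
    and 0: "H 0 = 0" "G 0 = 0" and fHG: "\<And>z. z \<in> ball 0 1 \<Longrightarrow> f z = H z + cnj (G z)"
    by (rule harmonic_decomposition[OF harm f0]) blast
  define A where "A = deriv H 0"
  define B where "B = deriv G 0"
  have df: "(f has_derivative (\<lambda>v. A * v + cnj (B * v))) (at 0)"
    unfolding A_def B_def by (rule harmonic_on_holomorphic_plus_cnj(2)[OF H G open_ball fHG]) auto
  then have L: "?L = (\<lambda>v. A * v + cnj (B * v))" by (rule frechet_derivative_at[symmetric])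
  have AB: "A = 0 \<or> B = 0" using conf unfolding L by (rule conformal_linear_imp_zero)
  have on: "onorm ?L = norm A + norm B"
    unfolding L by (rule onorm_scaling[OF has_derivative_bounded_linear[OF df] norm_linear_plus_cnj[OF AB]])
  have "onorm ?L \<le> c \<and> (onorm ?L = c \<longrightarrow>
      (\<exists>\<theta>::real. \<forall>z\<in>ball 0 1. f z = F (exp (\<i> * \<theta>) * z)) \<or>
      (\<exists>\<theta>::real. \<forall>z\<in>ball 0 1. f z = F (exp (\<i> * \<theta>) * cnj z)))"
    using AB
  proof
    assume B: "B = 0"
    have into: "H z + cnj (G z) \<in> D" if "z \<in> ball 0 1" for z
      using fD[OF that] fHG[OF that] by simp
    note ext = sense_preserving_extremal[OF H G 0 into B[unfolded B_def]]
    have "onorm ?L = norm (deriv H 0)" using on B by (simp add: A_def)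
    then show ?thesis using ext fHG by auto
  next
    assume A: "A = 0"
    \<comment> \<open>The map \<open>f (cnj z)\<close> has the reflected \<open>G\<close> as
      holomorphic part and the reflected \<open>H\<close> as the part under conjugation, so
      \<open>A = 0\<close> puts it in the sense preserving case.\<close>
    note Hc = holomorphic_reflect[OF H] and Gc = holomorphic_reflect[OF G]
    have f': "cnj (G (cnj z)) + cnj (cnj (H (cnj z))) = f (cnj z)" if "z \<in> ball 0 1" for z
      using fHG[of "cnj z"] that by simp
    have into: "cnj (G (cnj z)) + cnj (cnj (H (cnj z))) \<in> D" if "z \<in> ball 0 1" for z
      unfolding f'[OF that] by (rule fD) (use that in simp)
    have zero': "cnj (G (cnj 0)) = 0" "cnj (H (cnj 0)) = 0" using 0 by simp_all
    have A': "deriv (\<lambda>z. cnj (H (cnj z))) 0 = 0" using A Hc by (simp add: A_def)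
    note ext = sense_preserving_extremal[OF Gc(1) Hc(1) zero' into A']
    have n: "onorm ?L = norm (deriv (\<lambda>z. cnj (G (cnj z))) 0)"
      using on A Gc(2) by (simp add: B_def)
    have "\<exists>\<theta>::real. \<forall>z\<in>ball 0 1. f z = F (exp (\<i> * \<theta>) * cnj z)" if eq: "onorm ?L = c"
    proof -
      obtain \<theta> :: real where \<theta>: "\<And>z. z \<in> ball 0 1 \<Longrightarrow>
          cnj (G (cnj z)) + cnj (cnj (H (cnj z))) = F (exp (\<i> * \<theta>) * z)"
        using ext(2) n eq by metis
      have "f z = F (exp (\<i> * \<theta>) * cnj z)" if "z \<in> ball 0 1" for z
        using \<theta>[of "cnj z"] f'[of "cnj z"] that by simp
      then show ?thesis by blast
    qed
    then show ?thesis using ext(1) n by auto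
  qed
  then show "onorm ?L \<le> c" "onorm ?L = c \<Longrightarrow>
      (\<exists>\<theta>::real. \<forall>z\<in>ball 0 1. f z = F (exp (\<i> * \<theta>) * z)) \<or>
      (\<exists>\<theta>::real. \<forall>z\<in>ball 0 1. f z = F (exp (\<i> * \<theta>) * cnj z))"
    by blast+
qed

lemma admissible_plus_cnj:
  assumes H: "H holomorphic_on ball 0 1" and G: "G holomorphic_on ball 0 1"
    and fHG: "\<And>z. z \<in> ball 0 1 \<Longrightarrow> f z = H z + cnj (G z)"
    and f0: "f 0 = 0" and fD: "\<And>z. z \<in> ball 0 1 \<Longrightarrow> f z \<in> D"
    and AB: "deriv H 0 = 0 \<or> deriv G 0 = 0" and c: "norm (deriv H 0) + norm (deriv G 0) = c"
  shows "admissible D 0 f" "onorm (frechet_derivative f (at 0)) = c"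
proof -
  let ?L = "\<lambda>v. deriv H 0 * v + cnj (deriv G 0 * v)"
  have df: "(f has_derivative ?L) (at 0)"
    by (rule harmonic_on_holomorphic_plus_cnj(2)[OF H G open_ball fHG]) auto
  then have L: "frechet_derivative f (at 0) = ?L" by (rule frechet_derivative_at[symmetric])
  have n: "norm (?L v) = c * norm v" for v using norm_linear_plus_cnj[OF AB] c by simp
  have bl: "bounded_linear ?L" using df by (rule has_derivative_bounded_linear)
  show "onorm (frechet_derivative f (at 0)) = c" unfolding L by (rule onorm_scaling[OF bl n])
  have "conformal_linear ?L"
    by (rule conformal_linear_scaling[OF bounded_linear.linear[OF bl] n c_pos])
  moreover have "harmonic_on f (ball 0 1)"
    by (rule harmonic_on_holomorphic_plus_cnj(1)[OF H G open_ball fHG])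
  ultimately show "admissible D 0 f" unfolding admissible_def L using f0 fD by auto
qed

lemma rotations_admissible:
  assumes "(\<exists>\<theta>::real. \<forall>z\<in>ball 0 1. f z = F (exp (\<i> * \<theta>) * z)) \<or>
      (\<exists>\<theta>::real. \<forall>z\<in>ball 0 1. f z = F (exp (\<i> * \<theta>) * cnj z))"
  shows "admissible D 0 f \<and> onorm (frechet_derivative f (at 0)) = c"
  using assms
proof (elim disjE exE)
  fix \<theta> :: real assume f: "\<forall>z\<in>ball 0 1. f z = F (exp (\<i> * \<theta>) * z)"
  let ?u = "exp (\<i> * \<theta>)"
  have u: "norm ?u = 1" by simp
  note r = deriv_rotate[OF holomorphic_on_subset[OF holomorphic_F ball_1_subset(1)] u]
  have "f z \<in> D" if "z \<in> ball 0 1" for z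
    using that f u by (auto simp: norm_mult)
  then show ?thesis
    using f r F_0 c_pos
    by (intro conjI admissible_plus_cnj[OF r(1) holomorphic_on_const[of 0]])
       (auto simp: norm_mult deriv_F_0)
next
  fix \<theta> :: real assume f: "\<forall>z\<in>ball 0 1. f z = F (exp (\<i> * \<theta>) * cnj z)"
  let ?u = "exp (\<i> * \<theta>)"
  have u: "norm ?u = 1" by simp
  note r = deriv_rotate[OF holomorphic_on_subset[OF holomorphic_F ball_1_subset(1)] u]
  note r' = holomorphic_reflect[OF r(1)]
  have "f z \<in> D" if "z \<in> ball 0 1" for z
    using that f u by (auto simp: norm_mult)
  then show ?thesis
    using f r r' F_0 c_pos
    by (intro conjI admissible_plus_cnj[OF holomorphic_on_const[of 0] r'(1)])
       (auto simp: norm_mult deriv_F_0)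
qed

lemma M_D: "M D 0 = ereal c"
proof (rule antisym)
  show "M D 0 \<le> ereal c"
    unfolding M_def by (rule SUP_least) (simp add: admissible_extremal(1))
  have "\<forall>z\<in>ball 0 1. F z = F (exp (\<i> * complex_of_real 0) * z)" by simp
  then have "admissible D 0 F \<and> onorm (frechet_derivative F (at 0)) = c"
    using rotations_admissible by blast
  then show "ereal c \<le> M D 0"
    unfolding M_def by (intro SUP_upper2[of F]) auto
qed

end

section \<open>Factorisation of the quadratic and extension across the circle\<close>

text \<open>\<open>F\<close> is prescribed only inside the open unit disc, so an extension
  \<open>E\<close> is built as a primitive on a larger disc. Both have the same derivative and
  vanish at 0, hence agree inside.\<close>

lemma quadratic_map_exists:
  fixes a lam :: complex and c :: real and F :: "complex \<Rightarrow> complex"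
  assumes noroots: "\<forall>z. norm z \<le> 1 \<longrightarrow> 1 + a * z + lam * z\<^sup>2 \<noteq> 0"
    and cpos: "c > 0"
    and Fhol: "F holomorphic_on ball 0 1"
    and F0: "F 0 = 0"
    and Fderiv: "\<forall>z\<in>ball 0 1. deriv F z = complex_of_real c / (1 + a * z + lam * z\<^sup>2)"
  obtains E \<alpha> \<beta> R where "quadratic_map E \<alpha> \<beta> c R" "\<And>z. z \<in> ball 0 1 \<Longrightarrow> F z = E z"
proof -
  define s where "s = csqrt (a\<^sup>2 - 4 * lam)"
  define \<alpha> where "\<alpha> = (- a + s) / 2"
  define \<beta> where "\<beta> = (- a - s) / 2"
  have s2: "s * s = a * a - 4 * lam" by (simp add: s_def power2_eq_square[symmetric])
  have "\<alpha> + \<beta> = - a" by (simp add: \<alpha>_def \<beta>_def field_simps)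
  moreover have "\<alpha> * \<beta> = lam"
  proof -
    have "\<alpha> * \<beta> = (a * a - s * s) / 4" by (simp add: \<alpha>_def \<beta>_def field_simps)
    then show ?thesis by (simp add: s2)
  qed
  ultimately have al: "a = - (\<alpha> + \<beta>)" "lam = \<alpha> * \<beta>" by (auto simp: minus_equation_iff)
  have fac: "1 + a * z + lam * z\<^sup>2 = (1 - \<alpha> * z) * (1 - \<beta> * z)" for z
    by (simp add: al power2_eq_square algebra_simps)
  have small: "norm x < 1" if "x = \<alpha> \<or> x = \<beta>" for x
  proof (rule ccontr)
    assume x: "\<not> norm x < 1"
    then have "x \<noteq> 0" by auto
    then have "1 + a * (1/x) + lam * (1/x)\<^sup>2 = 0" unfolding fac using that by auto
    moreover have "norm (1/x) \<le> 1" using x by (simp add: norm_divide divide_le_eq_1)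
    ultimately show False using noroots by blast
  qed
  \<comment> \<open>The entry \<open>1/2\<close> keeps \<open>m\<close> positive when \<alpha> and
    \<beta> both vanish, so that \<open>R = 1 / m\<close> is meaningful.\<close>
  define m where "m = max (1/2) (max (norm \<alpha>) (norm \<beta>))"
  define R where "R = 1 / m"
  have m: "0 < m" "m < 1" "norm \<alpha> \<le> m" "norm \<beta> \<le> m" using small by (auto simp: m_def)
  have R: "R > 1" "norm \<alpha> * R \<le> 1" "norm \<beta> * R \<le> 1" using m by (auto simp: R_def)
  have nz: "1 - x * z \<noteq> 0" if "norm x * R \<le> 1" "norm z < R" for x z :: complex
    using norm_mult_less_1[OF that] by auto
  have "(\<lambda>z. c / ((1 - \<alpha>*z) * (1 - \<beta>*z))) holomorphic_on ball 0 R"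
    using nz R by (intro holomorphic_intros) auto
  from holomorphic_convex_primitive'[OF convex_ball open_ball this]
  obtain E0 where E0: "\<And>z. z \<in> ball 0 R \<Longrightarrow>
      (E0 has_field_derivative c / ((1 - \<alpha>*z) * (1 - \<beta>*z))) (at z within ball 0 R)"
    by blast
  define E where "E z = E0 z - E0 0" for z
  have E: "(E has_field_derivative c / ((1 - \<alpha>*z) * (1 - \<beta>*z))) (at z)" if "norm z < R" for z
  proof -
    have z: "z \<in> ball 0 R" using that by simp
    show ?thesis
      using DERIV_diff[OF E0[OF z] DERIV_const[of "E0 0"]]
      unfolding E_def[abs_def] at_within_open[OF z open_ball] by simp
  qed
  have "((\<lambda>z. F z - E z) has_field_derivative 0) (at z within ball 0 1)" if z: "z \<in> ball 0 1" for z
  proof -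
    have "(F has_field_derivative c / ((1 - \<alpha>*z) * (1 - \<beta>*z))) (at z)"
      using holomorphic_derivI[OF Fhol open_ball z] Fderiv z by (simp add: fac)
    from DERIV_diff[OF this E[of z]] show ?thesis
      using z R(1) by (auto intro: has_field_derivative_at_within)
  qed
  then obtain k where k: "\<And>z. z \<in> ball 0 1 \<Longrightarrow> F z - E z = k"
    using has_field_derivative_zero_constant[OF convex_ball, of 0 1 "\<lambda>z. F z - E z"] by blast
  have "k = 0" using k[of 0] F0 by (simp add: E_def)
  then have "F z = E z" if "z \<in> ball 0 1" for z using k[OF that] by simp
  moreover have "quadratic_map E \<alpha> \<beta> c R"
    using cpos R E by unfold_locales (auto simp: E_def)
  ultimately show ?thesis using that by blast
qed

theorem theorem1p1:
  fixes a lam :: complex and c :: real and F :: "complex \<Rightarrow> complex"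
  assumes noroots: "\<forall>z. norm z \<le> 1 \<longrightarrow> 1 + a * z + lam * z\<^sup>2 \<noteq> 0"
    and cpos: "c > 0"
    and Fhol: "F holomorphic_on unit_disc"
    and F0: "F 0 = 0"
    and Fderiv: "\<forall>z\<in>unit_disc. deriv F z = complex_of_real c / (1 + a * z + lam * z\<^sup>2)"
  shows "inj_on F unit_disc \<and>
         (\<exists>G. G holomorphic_on F ` unit_disc \<and> (\<forall>z\<in>unit_disc. G (F z) = z)) \<and>
         strongly_convex_domain (F ` unit_disc) \<and>
         M (F ` unit_disc) 0 = ereal (norm (deriv F 0)) \<and>
         norm (deriv F 0) = c \<and>
         (\<forall>f. (admissible (F ` unit_disc) 0 f \<and>
                ereal (onorm (frechet_derivative f (at 0))) = M (F ` unit_disc) 0)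
              \<longleftrightarrow> ((\<exists>\<theta>::real. \<forall>z\<in>unit_disc. f z = F (exp (\<i> * \<theta>) * z)) \<or>
                   (\<exists>\<theta>::real. \<forall>z\<in>unit_disc. f z = F (exp (\<i> * \<theta>) * cnj z))))"
proof -
  obtain E \<alpha> \<beta> R where "quadratic_map E \<alpha> \<beta> c R"
    and FE: "\<And>z. z \<in> unit_disc \<Longrightarrow> F z = E z"
    using quadratic_map_exists[OF assms] by blast
  then interpret quadratic_map E \<alpha> \<beta> c R by blast
  have img: "F ` unit_disc = E ` unit_disc" using FE by (rule image_cong[OF refl])
  have inj: "inj_on F unit_disc"
    by (subst inj_on_cong[OF FE]) (auto intro: inj_on_subset[OF inj_on_F ball_1_subset(1)])
  have "\<exists>G. G holomorphic_on F ` unit_disc \<and> (\<forall>z\<in>unit_disc. G (F z) = z)"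
    by (rule holomorphic_has_inverse[OF Fhol open_ball inj]) blast
  moreover have d: "norm (deriv F 0) = c" using Fderiv cpos by simp
  \<comment> \<open>Rotation and conjugation preserve the unit disc, so \<open>F\<close> is
    evaluated only where it coincides with \<open>E\<close>.\<close>
  moreover have "(\<forall>z\<in>unit_disc. f z = F (exp (\<i> * \<theta>) * z)) \<longleftrightarrow> (\<forall>z\<in>unit_disc. f z = E (exp (\<i> * \<theta>) * z))"
      "(\<forall>z\<in>unit_disc. f z = F (exp (\<i> * \<theta>) * cnj z)) \<longleftrightarrow> (\<forall>z\<in>unit_disc. f z = E (exp (\<i> * \<theta>) * cnj z))"
    for f :: "complex \<Rightarrow> complex" and \<theta> :: real
    by (auto simp: FE norm_mult)
  then have "(admissible (F ` unit_disc) 0 f \<and> ereal (onorm (frechet_derivative f (at 0))) = M (F ` unit_disc) 0)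
              \<longleftrightarrow> ((\<exists>\<theta>::real. \<forall>z\<in>unit_disc. f z = F (exp (\<i> * \<theta>) * z)) \<or>
                   (\<exists>\<theta>::real. \<forall>z\<in>unit_disc. f z = F (exp (\<i> * \<theta>) * cnj z)))" for f
    unfolding img M_D ereal.inject using admissible_extremal(2)[of f] rotations_admissible[of f]
    by (simp only:) blast
  ultimately show ?thesis
    using inj strongly_convex_D M_D by (simp add: img)
qed

end
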